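(* Let $n\ge 2$ be an integer, let $\gamma>0$, let $\alpha_1,\dots,\alpha_n>0$ be such that the polynomial $s^n+\alpha_n s^{n-1}+\alpha_{n-1}s^{n-2}+\cdots+\alpha_2 s+\alpha_1$ is Hurwitz, let $e_z\in\mathbb{R}^3$ be a unit vector, and consider the time-invariant ODE $$\begin{cases}\dot z_{p_i}=z_{p_{i+1}},\quad i=1,\dots,n-1,\\ \dot z_{p_n}=-\sum_{i=1}^n\alpha_i z_{p_i},\\ \dot z_2=\gamma\,S^2(e_z-z_2)\,(z_2-z_{p_1}),\end{cases}\qquad(\mathrm{E}_n)$$ with state $\xi_n=(z_{p_1},\dots,z_{p_n},z_2)\in\Upsilon_n=\mathbb{R}^{3n}\times\mathbb{S}_{e_z}$. Then the following hold. (1) The state space of $(\mathrm{E}_n)$ is $\Upsilon_n$ (i.e. $(\mathrm{E}_n)$ defines a dynamical system on $\Upsilon_n$), it admits exactly two equilibrium points, namely the origin $(0,0)$ and $(0,2e_z)$ (where the first $0$ is in $\mathbb{R}^{3n}$), and every trajectory of $(\mathrm{E}_n)$ in $\Upsilon_n$ converges to one of these two equilibrium points. (a) The system $(\mathrm{E}_n)$ on $\Upsilon_n$ is almost globally asymptotically stable with respect to the origin $(0,0)$, and the origin is locally exponentially stable. (b) For every compact subset $K$ of $\Upsilon_n^*=\mathbb{R}^{3n}\times(\mathbb{S}_{e_z}\setminus\{2e_z\})$ and every $\varrho>0$, there exist gains $(\alpha_1,\dots,\alpha_n,\gamma)$, all positive and with the polynomial $s^n+\alpha_n s^{n-1}+\alpha_{n-1}s^{n-2}+\cdots+\alpha_2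 s+\alpha_1$ Hurwitz, such that all trajectories of $(\mathrm{E}_n)$ (with these gains) starting in $K$ converge exponentially to the origin with an exponential rate larger than or equal to $\varrho$.
   Context: For $v\in\mathbb{R}^3$, $S(v)$ denotes the $3\times 3$ skew-symmetric matrix with $S(v)w=v\times w$ for all $w\in\mathbb{R}^3$, and $S^2(v)=S(v)S(v)$. Each $z_{p_i}$ and $z_2$ is a vector of $\mathbb{R}^3$. $\mathbb{S}^2=\{x\in\mathbb{R}^3:\|x\|=1\}$, and $\mathbb{S}_{e_z}=\{z\in\mathbb{R}^3: e_z-z\in\mathbb{S}^2\}$ (the unit sphere centered at $e_z$). A real polynomial is Hurwitz if all its roots have negative real part. A dynamical system $\dot x=f(x)$ on a differential manifold $X$ is called almost globally asymptotically stable with respect to an equilibrium point $x_0$ of $f$ if it is (Lyapunov) locally stable with respect to $x_0$ and there exists an open and dense subset $X_1$ of $X$ such that every trajectory starting in $X_1$ converges asymptotically to $x_0$. A trajectory $\xi(t)$ converges exponentially to the origin with exponential rate larger than or equal to $\varrho$ if there is a constant $C>0$ with $\|\xi(t)\|\le C e^{-\varrho t}$ for all $t\ge 0$. *)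

theory Defs
  imports "HOL-Analysis.Analysis" "HOL-Computational_Algebra.Polynomial"
begin

definition skew :: "real ^ 3 \<Rightarrow> real ^ 3 ^ 3" where
  "skew v = matrix (cross3 v)"

lemma skew_mult: "skew v *v w = cross3 v w"
proof -
  have "linear (cross3 v)"
    using bilinear_cross by (simp add: bilinear_def)
  then show ?thesis
    by (simp add: skew_def matrix_works)
qed

definition sphere_at :: "real ^ 3 \<Rightarrow> (real ^ 3) set" where
  "sphere_at e = {z. e - z \<in> sphere 0 1}"

definition hurwitz :: "real poly \<Rightarrow> bool" where
  "hurwitz p \<longleftrightarrow> (\<forall>s :: complex. poly (map_poly complex_of_real p) s = 0 \<longrightarrow> Re s < 0)"

text \<open>The polynomial $s^n + \alpha_n s^{n-1} + \dots + \alpha_2 s + \alpha_1$.\<close>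

definition char_poly_of_gains :: "nat \<Rightarrow> (nat \<Rightarrow> real) \<Rightarrow> real poly" where
  "char_poly_of_gains n \<alpha> = monom 1 n + (\<Sum>i=1..n. monom (\<alpha> i) (i - 1))"

text \<open>A point of $\mathbb{R}^{3n} \times \mathbb{R}^3$ is a pair \<open>(zp, z2)\<close> with
  \<open>zp :: (real ^ 3) ^ 'n\<close>. The map \<open>idx\<close>, assumed to be a bijection from
  \<open>{1..n}\<close> to the index type \<open>'n\<close>, numbers the blocks: $z_{p_i}$ is \<open>zp $ idx i\<close>.
  The lemmas below the definition give the components in terms of this numbering.\<close>

definition E_field ::
  "nat \<Rightarrow> (nat \<Rightarrow> 'n::finite) \<Rightarrow> (nat \<Rightarrow> real) \<Rightarrow> real \<Rightarrow> real ^ 3 \<Rightarrow>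
    ((real ^ 3) ^ 'n) \<times> (real ^ 3) \<Rightarrow> ((real ^ 3) ^ 'n) \<times> (real ^ 3)" where
  "E_field n idx \<alpha> \<gamma> e = (\<lambda>(zp, z2).
     (\<chi> k. if k = idx n then - (\<Sum>i=1..n. \<alpha> i *\<^sub>R (zp $ idx i))
           else zp $ idx (inv_into {1..n} idx k + 1),
      \<gamma> *\<^sub>R ((skew (e - z2) ** skew (e - z2)) *v (z2 - zp $ idx 1))))"

lemma E_field_chain:
  assumes "bij_betw idx {1..n} UNIV" and "i \<in> {1..<n}"
  shows "fst (E_field n idx \<alpha> \<gamma> e (zp, z2)) $ idx i = zp $ idx (i + 1)"
proof -
  have inj: "inj_on idx {1..n}"
    using assms(1) by (simp add: bij_betw_def)
  then have "idx i \<noteq> idx n"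
    using assms(2) by (auto dest: inj_onD)
  moreover have "inv_into {1..n} idx (idx i) = i"
    using inj assms(2) by (intro inv_into_f_f) auto
  ultimately show ?thesis
    by (simp add: E_field_def)
qed

lemma E_field_last:
  "fst (E_field n idx \<alpha> \<gamma> e (zp, z2)) $ idx n = - (\<Sum>i=1..n. \<alpha> i *\<^sub>R (zp $ idx i))"
  by (simp add: E_field_def)

lemma E_field_z2:
  "snd (E_field n idx \<alpha> \<gamma> e (zp, z2)) =
     \<gamma> *\<^sub>R ((skew (e - z2) ** skew (e - z2)) *v (z2 - zp $ idx 1))"
  by (simp add: E_field_def)

definition Upsilon :: "real ^ 3 \<Rightarrow> (((real ^ 3) ^ 'n::finite) \<times> (real ^ 3)) set" where
  "Upsilon e = UNIV \<times> sphere_at e"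

definition Upsilon_star :: "real ^ 3 \<Rightarrow> (((real ^ 3) ^ 'n::finite) \<times> (real ^ 3)) set" where
  "Upsilon_star e = UNIV \<times> (sphere_at e - {2 *\<^sub>R e})"

definition solves_ode_on :: "('a \<Rightarrow> 'a) \<Rightarrow> real set \<Rightarrow> (real \<Rightarrow> 'a::real_normed_vector) \<Rightarrow> bool" where
  "solves_ode_on f I \<xi> \<longleftrightarrow> (\<forall>t\<in>I. (\<xi> has_vector_derivative f (\<xi> t)) (at t within I))"

definition trajectory :: "('a \<Rightarrow> 'a) \<Rightarrow> 'a set \<Rightarrow> (real \<Rightarrow> 'a::real_normed_vector) \<Rightarrow> bool" where
  "trajectory f X \<xi> \<longleftrightarrow> solves_ode_on f {0..} \<xi> \<and> (\<forall>t\<ge>0. \<xi> t \<in> X)"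

text \<open>The vector field is defined on the ambient space, so that \<open>X\<close> being a state space is
  a property: the solutions issued from \<open>X\<close> exist for all $t \ge 0$, remain in \<open>X\<close>, are
  unique even among all solutions in the ambient space, and depend continuously on time and
  initial value.\<close>

definition dynamical_system_on :: "('a \<Rightarrow> 'a) \<Rightarrow> 'a::real_normed_vector set \<Rightarrow> bool" where
  "dynamical_system_on f X \<longleftrightarrow>
     (\<exists>\<phi>. continuous_on ({0..} \<times> X) (\<lambda>(t, x). \<phi> t x) \<and>
       (\<forall>x\<in>X. \<phi> 0 x = x \<and> trajectory f X (\<lambda>t. \<phi> t x) \<and>
         (\<forall>T>0. \<forall>\<xi>. solves_ode_on f {0..<T} \<xi> \<and> \<xi> 0 = x \<longrightarrow> (\<forall>t\<in>{0..<T}. \<xi> t = \<phi> t x))))"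

definition equilibria :: "('a \<Rightarrow> 'a) \<Rightarrow> 'a::real_normed_vector set \<Rightarrow> 'a set" where
  "equilibria f X = {x \<in> X. f x = 0}"

definition locally_stable :: "('a \<Rightarrow> 'a) \<Rightarrow> 'a::real_normed_vector set \<Rightarrow> 'a \<Rightarrow> bool" where
  "locally_stable f X x0 \<longleftrightarrow>
     (\<forall>\<epsilon>>0. \<exists>\<delta>>0. \<forall>\<xi>. trajectory f X \<xi> \<and> dist (\<xi> 0) x0 < \<delta> \<longrightarrow> (\<forall>t\<ge>0. dist (\<xi> t) x0 < \<epsilon>))"

definition almost_globally_asymptotically_stable ::
  "('a \<Rightarrow> 'a) \<Rightarrow> 'a::real_normed_vector set \<Rightarrow> 'a \<Rightarrow> bool" where
  "almost_globally_asymptotically_stable f X x0 \<longleftrightarrow>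
     x0 \<in> equilibria f X \<and> locally_stable f X x0 \<and>
     (\<exists>X1. openin (top_of_set X) X1 \<and> X \<subseteq> closure X1 \<and>
       (\<forall>\<xi>. trajectory f X \<xi> \<and> \<xi> 0 \<in> X1 \<longrightarrow> (\<xi> \<longlongrightarrow> x0) at_top))"

definition locally_exponentially_stable ::
  "('a \<Rightarrow> 'a) \<Rightarrow> 'a::real_normed_vector set \<Rightarrow> 'a \<Rightarrow> bool" where
  "locally_exponentially_stable f X x0 \<longleftrightarrow>
     (\<exists>\<delta>>0. \<exists>C>0. \<exists>\<kappa>>0. \<forall>\<xi>. trajectory f X \<xi> \<and> dist (\<xi> 0) x0 < \<delta> \<longrightarrow>
       (\<forall>t\<ge>0. dist (\<xi> t) x0 \<le> C * exp (- \<kappa> * t) * dist (\<xi> 0) x0))"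

definition converges_exp_rate :: "(real \<Rightarrow> 'a::real_normed_vector) \<Rightarrow> real \<Rightarrow> bool" where
  "converges_exp_rate \<xi> \<rho> \<longleftrightarrow> (\<exists>C>0. \<forall>t\<ge>0. norm (\<xi> t) \<le> C * exp (- \<rho> * t))"

end

(*
  The integrator chain is linear and decouples: factoring its characteristic polynomial over the
  complex numbers turns it into scalar equations y' = l y + g with Re l < 0, so z_p decays
  exponentially. With w = e_z - z_2 and p = z_{p_1}, the remaining equation reads
  w' = gamma (u - (w.u) w) on the unit sphere, where u = e_z - p, and the height 1 + w.e_z
  satisfies (1 + w.e)' >= gamma ((1 + w.e)(1 - w.e) - |p|). Since p is integrable, a height that is
  once large compared with the tail of p stays bounded below, and then 1 - w.e decays exponentially;
  otherwise w tends to -e_z. For a given initial z_p at most one initial w tends to -e_z, because the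
  defect 1 - w.w' between two such solutions would grow exponentially; hence the basin of the origin
  is dense. For part (b), scaling alpha_i by a^(n+1-i) speeds the chain up by the factor a without
  increasing the overshoot of p, so that the integral of |p| is as small as desired.
*)

theory Submission
  imports Defs "HOL-Computational_Algebra.Fundamental_Theorem_Algebra"
begin

section \<open>Differential inequalities\<close>

text \<open>But two confinements are known in advance: the linear part bounds z_p by its initial
  value, and the distance from z_2 to e_z is conserved. On the confined region a radially truncated,
  globally Lipschitz field has the same solutions, and its flow serves as the flow of the system.
  The rate \<open>k\<close> is taken strictly inside the spectral gap, so that repeated roots cost a
  constant instead of powers of t. One inequality, \<open>\<gamma> * M \<le> k * \<delta>\<close>,
  governs every convergence claim: \<open>\<gamma> * M / k\<close> bounds the total height that the
  perturbation can take away, and the initial height is at least \<open>2 * \<delta>\<close>. It is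
  met by small data near the origin, by waiting in the global argument, and by a fast chain in the
  tuning. Density of the basin is obtained by moving z_2 alone: this leaves p unchanged, so two
  solutions on the sphere can be compared directly. Openness comes from local exponential stability
  and continuity of the flow.\<close>

lemma has_vector_derivative_at_interior:
  fixes t T :: real
  assumes "(f has_vector_derivative d) (at t within {0..<T})" "0 < t" "t < T"
  shows "(f has_vector_derivative d) (at t)"
proof -
  have "at t within {0..<T} = at t"
    using assms(2,3) by (intro at_within_interior) simp
  with assms(1) show ?thesis by simp
qed

lemma has_vector_derivative_imp_continuous_on:
  assumes "\<And>t. t \<in> S \<Longrightarrow> (f has_vector_derivative f' t) (at t within S)"
  shows "continuous_on S f"
  unfolding continuous_on_eq_continuous_within
  using assms has_vector_derivative_continuous by blast

lemma exp_decay_tendsto_0: "k > 0 \<Longrightarrow> ((\<lambda>t. A * exp (- k * t)) \<longlongrightarrow> (0 :: real)) at_top"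
proof -
  assume "k > 0"
  then have "LIM t at_top. - k * t :> at_bot"
    using filterlim_tendsto_neg_mult_at_bot[OF tendsto_const _ filterlim_ident, of "- k"] by simp
  then have "((\<lambda>t. A * exp (- k * t)) \<longlongrightarrow> A * 0) at_top"
    by (intro tendsto_mult_left filterlim_compose[OF exp_at_bot])
  then show ?thesis by simp
qed

lemma has_vector_derivative_shift:
  fixes s t :: real
  assumes "(f has_vector_derivative d) (at (s + t) within U)" "(\<lambda>t. s + t) ` S \<subseteq> U"
  shows "((\<lambda>t. f (s + t)) has_vector_derivative d) (at t within S)"
proof -
  have "((\<lambda>t. s + t) has_vector_derivative 1) (at t within S)"
    by (auto intro!: derivative_eq_intros)
  moreover have "(f has_vector_derivative d) (at (s + t) within (\<lambda>t. s + t) ` S)"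
    using assms by (rule has_vector_derivative_within_subset)
  ultimately show ?thesis
    using vector_diff_chain_within[of "\<lambda>t. s + t" 1 t S f] by (simp add: o_def)
qed

lemma tendsto_at_top_shiftD:
  fixes f :: "real \<Rightarrow> 'a::topological_space"
  assumes "((\<lambda>t. f (s + t)) \<longlongrightarrow> l) at_top"
  shows "(f \<longlongrightarrow> l) at_top"
proof -
  have "LIM t at_top. - s + t :: real :> at_top"
    by (intro filterlim_tendsto_add_at_top[OF tendsto_const] filterlim_ident)
  from filterlim_compose[OF assms this] show ?thesis by simp
qed

lemma nonincreasing_on_halfopen:
  fixes h :: "real \<Rightarrow> real"
  assumes "\<And>t. t \<in> {0..<T} \<Longrightarrow> (h has_vector_derivative h' t) (at t within {0..<T})"
    and "\<And>t. t \<in> {0..<T} \<Longrightarrow> h' t \<le> 0"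
    and "s \<in> {0..<T}" "t \<in> {0..<T}" "s \<le> t"
  shows "h t \<le> h s"
proof (rule DERIV_nonpos_imp_decreasing_open[OF \<open>s \<le> t\<close>])
  fix x assume x: "s < x" "x < t"
  then have "(h has_vector_derivative h' x) (at x)"
    using assms by (intro has_vector_derivative_at_interior[of h _ x T]) auto
  then show "\<exists>y. DERIV h x :> y \<and> y \<le> 0"
    using assms x by (auto simp: has_real_derivative_iff_has_vector_derivative)
next
  show "continuous_on {s..t} h"
    using has_vector_derivative_imp_continuous_on[of "{0..<T}" h h'] assms(1,3,4)
    by (auto elim: continuous_on_subset)
qed

text \<open>Integrating factor: \<open>h t * exp (\<mu> * t)\<close>, plus a term absorbing the
  integrated forcing, is nonincreasing. The sign of \<open>\<mu>\<close> is free; a negative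
  \<open>\<mu>\<close> with \<open>M = 0\<close> gives Gronwall's inequality.\<close>

lemma exp_decay_forced:
  fixes h :: "real \<Rightarrow> real"
  assumes der: "\<And>t. t \<in> {0..<T} \<Longrightarrow> (h has_vector_derivative h' t) (at t within {0..<T})"
    and le: "\<And>t. t \<in> {0..<T} \<Longrightarrow> h' t \<le> - \<mu> * h t + M * exp (- k * t)"
    and k: "\<mu> < k" and M: "0 \<le> M" and t: "t \<in> {0..<T}"
  shows "h t \<le> (h 0 + M / (k - \<mu>)) * exp (- \<mu> * t)"
proof -
  define m where "m = k - \<mu>"
  have m: "m > 0" using k by (simp add: m_def)
  define g where "g = (\<lambda>t. h t * exp (\<mu> * t) + M / m * exp (- m * t))"
  define g' where "g' = (\<lambda>t. (h' t + \<mu> * h t) * exp (\<mu> * t) - M * exp (- m * t))"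
  have der': "(g has_vector_derivative g' t) (at t within {0..<T})" if "t \<in> {0..<T}" for t
    using der[OF that] m
    unfolding g_def g'_def has_real_derivative_iff_has_vector_derivative[symmetric]
    by (auto intro!: derivative_eq_intros simp: algebra_simps)
  have le': "g' t \<le> 0" if "t \<in> {0..<T}" for t
  proof -
    have "(h' t + \<mu> * h t) * exp (\<mu> * t) \<le> (M * exp (- k * t)) * exp (\<mu> * t)"
      using le[OF that] by (intro mult_right_mono) auto
    also have "\<dots> = M * exp (- m * t)"
      by (simp add: m_def exp_add[symmetric] algebra_simps)
    finally show ?thesis by (simp add: g'_def)
  qed
  have "g t \<le> g 0"
    using t by (intro nonincreasing_on_halfopen[where h = g and h' = g', OF der' le']) auto
  moreover have "0 \<le> M / m * exp (- m * t)"
    using m M by simp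
  ultimately have "h t * exp (\<mu> * t) \<le> h 0 + M / m"
    unfolding g_def by simp
  then have "h t * exp (\<mu> * t) * exp (- \<mu> * t) \<le> (h 0 + M / m) * exp (- \<mu> * t)"
    by (intro mult_right_mono) auto
  then show ?thesis by (simp add: m_def mult.assoc exp_add[symmetric])
qed

text \<open>Here the homogeneous part decays faster than the bound on the forcing, the opposite
  regime to \<open>exp_decay_forced\<close>. The rate \<open>k\<close> of the forcing survives
  without loss, so the estimate can be iterated over several linear factors, repeated ones
  included.\<close>

lemma exp_decay_complex_forced:
  fixes y :: "real \<Rightarrow> complex"
  assumes der: "\<And>t. t \<in> {0..<T} \<Longrightarrow> (y has_vector_derivative l * y t + g t) (at t within {0..<T})"
    and le: "\<And>t. t \<in> {0..<T} \<Longrightarrow> norm (g t) \<le> M * exp (- k * t)"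
    and l: "Re l < - k" and t: "t \<in> {0..<T}"
  shows "norm (y t) \<le> (norm (y 0) + M / (- k - Re l)) * exp (- k * t)"
proof -
  define m where "m = - k - Re l"
  have m: "m > 0" using l by (simp add: m_def)
  have M: "0 \<le> M"
  proof -
    have "0 \<le> norm (g 0)" by simp
    also have "\<dots> \<le> M" using le[of 0] t by auto
    finally show ?thesis .
  qed
  define z where "z = (\<lambda>t. y t * exp (- l * of_real t))"
  have z': "(z has_vector_derivative g t * exp (- l * of_real t)) (at t within {0..<T})"
    if "t \<in> {0..<T}" for t
    unfolding z_def
    by (rule derivative_eq_intros der[OF that] has_vector_derivative_real_field refl
        | simp add: algebra_simps)+
  have bnd: "norm (g t * exp (- l * of_real t)) \<le> M * exp (m * t)" if "t \<in> {0..<T}" for t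
  proof -
    have "norm (g t * exp (- l * of_real t)) = norm (g t) * exp (- Re l * t)"
      by (simp add: norm_mult)
    also have "\<dots> \<le> M * exp (- k * t) * exp (- Re l * t)"
      using le[OF that] by (intro mult_right_mono) auto
    also have "\<dots> = M * exp (m * t)"
      by (simp add: m_def exp_add[symmetric] algebra_simps)
    finally show ?thesis .
  qed
  have diff: "norm (z t - z 0) \<le> M / m * exp (m * t) - M / m"
  proof (cases "t = 0")
    case False
    then have "0 < t" using t by simp
    have "norm (z t - z 0) \<le> (\<lambda>t. M / m * exp (m * t)) t - (\<lambda>t. M / m * exp (m * t)) 0"
    proof (rule differentiable_bound_general[OF \<open>0 < t\<close>])
      show "continuous_on {0..t} z"
        using has_vector_derivative_imp_continuous_on[of "{0..<T}", OF z'] t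
        by (auto elim: continuous_on_subset)
      show "continuous_on {0..t} (\<lambda>t. M / m * exp (m * t))"
        by (intro continuous_intros)
      fix x assume x: "0 < x" "x < t"
      show "(z has_vector_derivative g x * exp (- l * of_real x)) (at x)"
        using x t by (intro has_vector_derivative_at_interior[OF z']) auto
      show "((\<lambda>t. M / m * exp (m * t)) has_vector_derivative M * exp (m * x)) (at x)"
        using m unfolding has_real_derivative_iff_has_vector_derivative[symmetric]
        by (auto intro!: derivative_eq_intros)
      show "norm (g x * exp (- l * of_real x)) \<le> M * exp (m * x)"
        using x t by (intro bnd) auto
    qed
    then show ?thesis by simp
  qed simp
  have "norm (z t) \<le> norm (y 0) + M / m * exp (m * t)"
  proof -
    have "norm (z t) \<le> norm (z 0) + norm (z t - z 0)"
      using norm_triangle_ineq[of "z 0" "z t - z 0"] by simp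
    also have "\<dots> \<le> norm (y 0) + M / m * exp (m * t)"
      using diff m M by (simp add: z_def) (use m M in \<open>smt (verit) divide_nonneg_pos\<close>)
    finally show ?thesis .
  qed
  also have "\<dots> \<le> (norm (y 0) + M / m) * exp (m * t)"
    using m t mult_left_mono[of 1 "exp (m * t)" "norm (y 0)"] by (simp add: algebra_simps)
  finally have zt: "norm (z t) \<le> (norm (y 0) + M / m) * exp (m * t)" .
  have "norm (y t) = norm (z t) * exp (Re l * t)"
    by (simp add: z_def norm_mult mult.assoc exp_add[symmetric])
  also have "\<dots> \<le> (norm (y 0) + M / m) * exp (m * t) * exp (Re l * t)"
    using zt by (intro mult_right_mono) auto
  also have "\<dots> = (norm (y 0) + M / m) * exp (- k * t)"
    by (simp add: mult.assoc exp_add[symmetric] m_def algebra_simps)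
  finally show ?thesis by (simp add: m_def)
qed

section \<open>Chains of integrators\<close>

text \<open>The codomain is left abstract because the same chain is used for vector blocks, for
  differences of solutions and for complex coordinates, where the polynomial can be
  factored.\<close>

definition chain_on :: "nat \<Rightarrow> (nat \<Rightarrow> real) \<Rightarrow> real \<Rightarrow> (nat \<Rightarrow> real \<Rightarrow> 'a::real_normed_vector) \<Rightarrow> bool" where
  "chain_on n \<alpha> T q \<longleftrightarrow> (\<forall>t\<in>{0..<T}.
     (\<forall>i\<in>{1..<n}. (q i has_vector_derivative q (Suc i) t) (at t within {0..<T})) \<and>
     (q n has_vector_derivative - (\<Sum>i=1..n. \<alpha> i *\<^sub>R q i t)) (at t within {0..<T}))"

lemma chain_on_bounded_linear:
  assumes "bounded_linear f" "chain_on n \<alpha> T q"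
  shows "chain_on n \<alpha> T (\<lambda>i t. f (q i t))"
proof -
  interpret f: bounded_linear f by fact
  have "(\<Sum>i=1..n. \<alpha> i *\<^sub>R f (q i t)) = f (\<Sum>i=1..n. \<alpha> i *\<^sub>R q i t)" for t
    by (simp add: f.sum f.scaleR)
  then show ?thesis
    using assms(2) unfolding chain_on_def
    by (auto simp: f.neg[symmetric] intro!: f.has_vector_derivative)
qed

lemma chain_on_diff:
  assumes "chain_on n \<alpha> T q" "chain_on n \<alpha> T r"
  shows "chain_on n \<alpha> T (\<lambda>i t. q i t - r i t)"
proof -
  have eq: "- (\<Sum>i=1..n. \<alpha> i *\<^sub>R (q i t - r i t)) =
      - (\<Sum>i=1..n. \<alpha> i *\<^sub>R q i t) - - (\<Sum>i=1..n. \<alpha> i *\<^sub>R r i t)" for t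
    by (simp add: scaleR_diff_right sum_subtractf)
  then show ?thesis
    using assms unfolding chain_on_def eq
    by (auto intro!: has_vector_derivative_diff simp del: minus_diff_minus diff_minus_eq_add)
qed

text \<open>A polynomial $r$ of degree at most $n$ acts on a solution as the differential operator
  $r(d/dt)$ applied to the first component.\<close>

definition chain_op :: "nat \<Rightarrow> (nat \<Rightarrow> real) \<Rightarrow> (nat \<Rightarrow> real \<Rightarrow> complex) \<Rightarrow> complex poly \<Rightarrow> real \<Rightarrow> complex" where
  "chain_op n \<alpha> q r t = (\<Sum>i<n. coeff r i * q (Suc i) t) - coeff r n * (\<Sum>i=1..n. of_real (\<alpha> i) * q i t)"

lemma chain_op_add: "chain_op n \<alpha> q (r + s) t = chain_op n \<alpha> q r t + chain_op n \<alpha> q s t"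
  by (simp add: chain_op_def sum.distrib algebra_simps)

lemma chain_op_smult: "chain_op n \<alpha> q (smult c r) t = c * chain_op n \<alpha> q r t"
  by (simp add: chain_op_def sum_distrib_left algebra_simps)

lemma chain_op_monom:
  assumes "i < n"
  shows "chain_op n \<alpha> q (monom 1 i) t = q (Suc i) t"
proof -
  have "(\<Sum>j<n. coeff (monom 1 i) j * q (Suc j) t) = (\<Sum>j<n. if j = i then q (Suc i) t else 0)"
    by (intro sum.cong) auto
  then show ?thesis
    using assms by (simp add: chain_op_def sum.delta)
qed

lemma coeff_char_poly_of_gains:
  "coeff (char_poly_of_gains n \<alpha>) i = (if i = n then 1 else if i < n then \<alpha> (Suc i) else 0)"
proof -
  have "(\<Sum>j=1..n. coeff (monom (\<alpha> j) (j - 1)) i) = (\<Sum>j=1..n. if j = Suc i then \<alpha> j else 0)"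
    by (intro sum.cong) auto
  then show ?thesis
    by (auto simp: char_poly_of_gains_def coeff_sum sum.delta)
qed

text \<open>The subtracted sum in \<open>chain_op\<close> stands for the n-th derivative as given by
  the closing equation, so the characteristic polynomial cancels identically.\<close>

lemma chain_op_char_poly:
  "chain_op n \<alpha> q (map_poly of_real (char_poly_of_gains n \<alpha>)) t = 0"
proof -
  have "(\<Sum>i<n. of_real (if i = n then 1 else if i < n then \<alpha> (Suc i) else 0) * q (Suc i) t) = (\<Sum>i=1..n. of_real (\<alpha> i) * q i t)"
    by (rule sum.reindex_bij_witness[of _ "\<lambda>i. i - 1" Suc]) auto
  then show ?thesis
    by (simp add: chain_op_def coeff_map_poly coeff_char_poly_of_gains)
qed

lemma degree_char_poly_of_gains: "degree (char_poly_of_gains n \<alpha>) = n"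
  by (rule antisym; (rule degree_le le_degree; simp add: coeff_char_poly_of_gains))

text \<open>Time differentiation is multiplication by the variable. The bound
  \<open>degree r < n\<close> keeps the product within degree \<open>n\<close>, where the closing
  equation evaluates the top coefficient.\<close>

lemma chain_op_has_vector_derivative:
  assumes "chain_on n \<alpha> T q" "degree r < n" "t \<in> {0..<T}"
  shows "(chain_op n \<alpha> q r has_vector_derivative chain_op n \<alpha> q (pCons 0 r) t) (at t within {0..<T})"
proof -
  obtain m where n: "n = Suc m" using assms(2) by (cases n) auto
  have "((\<lambda>t. (\<Sum>i<m. coeff r i * q (Suc i) t) + coeff r m * q n t) has_vector_derivative
     (\<Sum>i<m. coeff r i * q (Suc (Suc i)) t) + coeff r m * - (\<Sum>i=1..n. \<alpha> i *\<^sub>R q i t)) (at t within {0..<T})"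
    using assms n unfolding chain_on_def
    by (intro has_vector_derivative_add has_vector_derivative_sum has_vector_derivative_mult_right) auto
  moreover have "chain_op n \<alpha> q r = (\<lambda>t. (\<Sum>i<m. coeff r i * q (Suc i) t) + coeff r m * q n t)"
    using assms(2) by (simp add: fun_eq_iff chain_op_def n coeff_eq_0)
  moreover have "chain_op n \<alpha> q (pCons 0 r) t =
     (\<Sum>i<m. coeff r i * q (Suc (Suc i)) t) + coeff r m * - (\<Sum>i=1..n. \<alpha> i *\<^sub>R q i t)"
    by (simp add: chain_op_def n sum.lessThan_Suc_shift scaleR_conv_of_real
        del: sum.lessThan_Suc sum.cl_ivl_Suc)
  ultimately show ?thesis by simp
qed

lemma chain_op_initial_bound:
  "norm (chain_op n \<alpha> q r t) \<le>
     ((\<Sum>i<n. norm (coeff r i)) + norm (coeff r n) * (\<Sum>i=1..n. \<bar>\<alpha> i\<bar>)) * (\<Sum>i=1..n. norm (q i t))"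
proof -
  define N where "N = (\<Sum>i=1..n. norm (q i t))"
  have le: "norm (q i t) \<le> N" if "i \<in> {1..n}" for i
    unfolding N_def using that by (intro member_le_sum) auto
  have "norm (chain_op n \<alpha> q r t) \<le> norm (\<Sum>i<n. coeff r i * q (Suc i) t) +
      norm (coeff r n * (\<Sum>i=1..n. of_real (\<alpha> i) * q i t))"
    unfolding chain_op_def by (rule norm_triangle_ineq4)
  also have "\<dots> \<le> (\<Sum>i<n. norm (coeff r i) * N) + norm (coeff r n) * (\<Sum>i=1..n. \<bar>\<alpha> i\<bar> * N)"
    using le unfolding norm_mult
    by (intro add_mono sum_norm_le mult_left_mono) (auto simp: norm_mult intro!: mult_left_mono)
  also have "\<dots> = ((\<Sum>i<n. norm (coeff r i)) + norm (coeff r n) * (\<Sum>i=1..n. \<bar>\<alpha> i\<bar>)) * N"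
    by (simp add: sum_distrib_right distrib_right)
  finally show ?thesis by (simp add: N_def)
qed

text \<open>Induction on the cofactor \<open>Q\<close> of a divisor \<open>D\<close> of
  \<open>P\<close>: multiples of \<open>D\<close> vanish when \<open>D\<close> is associated to
  \<open>P\<close>, and decay persists as linear factors are stripped from \<open>D\<close> one by
  one. The constant is chosen before \<open>T\<close> and \<open>q\<close>, hence serves all
  solutions.\<close>

lemma chain_op_decay:
  fixes n :: nat and \<alpha> :: "nat \<Rightarrow> real" and P :: "complex poly"
  defines "P \<equiv> map_poly of_real (char_poly_of_gains n \<alpha>)"
  assumes roots: "\<And>l. poly P l = 0 \<Longrightarrow> Re l < - k"
    and "P = D * Q" "D dvd r" "degree r \<le> n"
  shows "\<exists>C\<ge>0. \<forall>T q. chain_on n \<alpha> T q \<longrightarrow>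
    (\<forall>t\<in>{0..<T}. norm (chain_op n \<alpha> q r t) \<le> C * (\<Sum>i=1..n. norm (q i 0)) * exp (- k * t))"
  using assms(3-)
proof (induction "degree Q" arbitrary: D Q r)
  case 0
  have P: "degree P = n" "P \<noteq> 0"
    using degree_char_poly_of_gains[of n \<alpha>] coeff_char_poly_of_gains[of n \<alpha> n]
    by (auto simp: P_def degree_map_poly map_poly_eq_0_iff)
  obtain c where c: "Q = [:c:]" using 0 degree_eq_zeroE by metis
  with P 0 have "c \<noteq> 0" by auto
  obtain s where s: "r = D * s" using 0 by blast
  have r: "r = P * smult (1 / c) s" using s 0(2) c \<open>c \<noteq> 0\<close> by simp
  \<comment> \<open>The degree bound leaves only scalar multiples among the multiples of
    \<open>P\<close>.\<close>
  obtain b where b: "r = smult b P"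
  proof (cases "s = 0")
    case False
    then have "degree s = 0"
      using r P 0(4) \<open>c \<noteq> 0\<close> by (simp add: degree_mult_eq)
    then obtain d where "s = [:d:]" using degree_eq_zeroE by metis
    then show ?thesis using r that[of "d / c"] by simp
  qed (use that[of 0] s in simp)
  show ?case
    by (rule exI[of _ 0]) (simp add: b chain_op_smult chain_op_char_poly P_def)
next
  case (Suc m)
  have P: "degree P = n" "P \<noteq> 0"
    using degree_char_poly_of_gains[of n \<alpha>] coeff_char_poly_of_gains[of n \<alpha> n]
    by (auto simp: P_def degree_map_poly map_poly_eq_0_iff)
  have "\<not> constant (poly Q)" using Suc(2) constant_degree[of Q] by simp
  then obtain l where l: "poly Q l = 0" using fundamental_theorem_of_algebra by blast
  then obtain Q' where Q': "Q = [:- l, 1:] * Q'" using poly_eq_0_iff_dvd by blast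
  have "poly P l = 0" using Suc l by simp
  then have Rel: "Re l < - k" by (rule roots)
  \<comment> \<open>\<open>chain_op\<close> of \<open>D\<close> solves \<open>y' = l y + g\<close>
    with \<open>g\<close> the \<open>chain_op\<close> of \<open>D'\<close>; the induction hypothesis
    bounds \<open>g\<close>, since the cofactor of \<open>D'\<close> has lost the root
    \<open>l\<close>.\<close>
  define D' where "D' = [:- l, 1:] * D"
  have nz: "Q' \<noteq> 0" "D \<noteq> 0" using P Suc Q' by auto
  have "degree Q = Suc (degree Q')"
    unfolding Q' using nz by (subst degree_mult_eq) auto
  then have m: "m = degree Q'" using Suc(2) by simp
  have P': "P = D' * Q'"
    unfolding Suc(3) Q' D'_def by (simp only: ac_simps)
  have degD: "degree D < n"
  proof -
    have "degree P = degree D + Suc m"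
      using Suc P Q' nz by (simp add: degree_mult_eq)
    then show ?thesis using P by simp
  qed
  define bnd where "bnd C s \<longleftrightarrow> (\<forall>T q. chain_on n \<alpha> T q \<longrightarrow> (\<forall>t\<in>{0..<T}.
    norm (chain_op n \<alpha> q s t) \<le> C * (\<Sum>i=1..n. norm (q i 0)) * exp (- k * t)))" for C s
  have IH: "\<exists>C\<ge>0. bnd C s" if "D' dvd s" "degree s \<le> n" for s
    using Suc(1)[OF m P' that] unfolding bnd_def .
  have degD': "degree D' \<le> n" unfolding D'_def using degD nz by (subst degree_mult_eq) auto
  from IH[OF dvd_refl degD'] obtain C1 where C1: "C1 \<ge> 0" "bnd C1 D'" by blast
  obtain s where s: "r = D * s" using Suc(4) by (rule dvdE)
  \<comment> \<open>Division of \<open>s\<close> by the linear factor leaves a constant, so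
    \<open>r\<close> is a multiple of \<open>D'\<close> plus a scalar times
    \<open>D\<close>.\<close>
  define h where "h = synthetic_div s l"
  have s_eq: "s = [:- l, 1:] * h + [:poly s l:]"
    using synthetic_div_correct'[of l s] by (simp add: h_def)
  have r: "r = D' * h + smult (poly s l) D"
    unfolding s by (subst s_eq) (simp add: D'_def algebra_simps)
  have "degree (D' * h) \<le> n"
  proof -
    have "D' * h = r - smult (poly s l) D" using r by simp
    also have "degree \<dots> \<le> n"
      using Suc(5) degD degree_smult_le[of "poly s l" D] by (intro degree_diff_le) linarith+
    finally show ?thesis .
  qed
  with IH[of "D' * h"] obtain C2 where C2: "C2 \<ge> 0" "bnd C2 (D' * h)" by auto
  define C3 where "C3 = ((\<Sum>i<n. norm (coeff D i)) + norm (coeff D n) * (\<Sum>i=1..n. \<bar>\<alpha> i\<bar>)) + C1 / (- k - Re l)"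
  have C3: "C3 \<ge> 0" using C1 Rel by (auto simp: C3_def sum_nonneg)
  have D_bound: "norm (chain_op n \<alpha> q D t) \<le> C3 * (\<Sum>i=1..n. norm (q i 0)) * exp (- k * t)"
    if q: "chain_on n \<alpha> T q" and t: "t \<in> {0..<T}" for T t and q :: "nat \<Rightarrow> real \<Rightarrow> complex"
  proof -
    have eq: "chain_op n \<alpha> q (pCons 0 D) u = l * chain_op n \<alpha> q D u + chain_op n \<alpha> q D' u" for u
      by (simp add: D'_def chain_op_smult[symmetric] chain_op_add[symmetric])
    have "norm (chain_op n \<alpha> q D t) \<le>
      (norm (chain_op n \<alpha> q D 0) + C1 * (\<Sum>i=1..n. norm (q i 0)) / (- k - Re l)) * exp (- k * t)"
      using chain_op_has_vector_derivative[OF q degD] C1(2)[unfolded bnd_def, rule_format, OF q] unfolding eq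
      by (rule exp_decay_complex_forced[OF _ _ Rel t])
    also have "\<dots> \<le> C3 * (\<Sum>i=1..n. norm (q i 0)) * exp (- k * t)"
      using chain_op_initial_bound[of n \<alpha> q D 0]
      by (intro mult_right_mono) (auto simp: C3_def distrib_right)
    finally show ?thesis .
  qed
  show ?case
  proof (intro exI[of _ "C2 + norm (poly s l) * C3"] conjI allI impI ballI)
    show "0 \<le> C2 + norm (poly s l) * C3" using C2 C3 by simp
    fix T t and q :: "nat \<Rightarrow> real \<Rightarrow> complex" assume q: "chain_on n \<alpha> T q" and t: "t \<in> {0..<T}"
    have "norm (chain_op n \<alpha> q r t) \<le> norm (chain_op n \<alpha> q (D' * h) t) +
        norm (poly s l) * norm (chain_op n \<alpha> q D t)"
      unfolding r chain_op_add chain_op_smult norm_mult[symmetric] by (rule norm_triangle_ineq)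
    also have "\<dots> \<le> C2 * (\<Sum>i=1..n. norm (q i 0)) * exp (- k * t) +
        norm (poly s l) * (C3 * (\<Sum>i=1..n. norm (q i 0)) * exp (- k * t))"
      using C2(2)[unfolded bnd_def, rule_format, OF q t] D_bound[OF q t] by (intro add_mono mult_left_mono) auto
    also have "\<dots> = (C2 + norm (poly s l) * C3) * (\<Sum>i=1..n. norm (q i 0)) * exp (- k * t)"
      by (simp add: algebra_simps)
    finally show "norm (chain_op n \<alpha> q r t) \<le>
      (C2 + norm (poly s l) * C3) * (\<Sum>i=1..n. norm (q i 0)) * exp (- k * t)" .
  qed
qed

section \<open>From the spectral gap to decay of vector-valued chains\<close>

lemma hurwitz_spectral_gap:
  assumes "hurwitz p" "p \<noteq> 0"
  obtains k where "k > 0" "\<And>l. poly (map_poly complex_of_real p) l = 0 \<Longrightarrow> Re l < - k"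
proof -
  define R where "R = {l. poly (map_poly complex_of_real p) l = 0}"
  have R: "finite R"
    unfolding R_def using assms(2) by (intro poly_roots_finite) (simp add: map_poly_eq_0_iff)
  \<comment> \<open>The inserted 1 covers a polynomial without roots; \<open>m / 2\<close> is
    returned below to make the inequality strict.\<close>
  define m where "m = Min (insert 1 ((\<lambda>l. - Re l) ` R))"
  have "m \<in> insert 1 ((\<lambda>l. - Re l) ` R)"
    unfolding m_def using R by (intro Min_in) auto
  then have "m > 0" using assms(1) by (auto simp: R_def hurwitz_def)
  moreover have "Re l \<le> - m" if "l \<in> R" for l
  proof -
    have "m \<le> - Re l" unfolding m_def using R that by (intro Min_le) auto
    then show ?thesis by simp
  qed
  ultimately show ?thesis
    using that[of "m / 2"] by (force simp: R_def)
qed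

lemma chain_decay_complex:
  assumes "hurwitz (char_poly_of_gains n \<alpha>)"
  obtains C k where "C > 0" "k > 0"
    "\<And>T q t i. chain_on n \<alpha> T (q :: nat \<Rightarrow> real \<Rightarrow> complex) \<Longrightarrow> t \<in> {0..<T} \<Longrightarrow> i \<in> {1..n} \<Longrightarrow>
       norm (q i t) \<le> C * (\<Sum>i=1..n. norm (q i 0)) * exp (- k * t)"
proof -
  have "char_poly_of_gains n \<alpha> \<noteq> 0"
    using coeff_char_poly_of_gains[of n \<alpha> n] by auto
  then obtain k where k: "k > 0"
    "\<And>l. poly (map_poly complex_of_real (char_poly_of_gains n \<alpha>)) l = 0 \<Longrightarrow> Re l < - k"
    using hurwitz_spectral_gap assms by blast
  define bnd where "bnd C i \<longleftrightarrow> (\<forall>T q. chain_on n \<alpha> T q \<longrightarrow> (\<forall>t\<in>{0..<T}.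
    norm (chain_op n \<alpha> q (monom 1 (i - 1)) t) \<le> C * (\<Sum>i=1..n. norm (q i 0)) * exp (- k * t)))" for C i
  have "\<exists>C\<ge>0. bnd C i" if "i \<in> {1..n}" for i
    unfolding bnd_def
    by (rule chain_op_decay[OF k(2), of n \<alpha> 1]) (use that in \<open>auto simp: degree_monom_eq\<close>)
  then obtain C where C: "\<And>i. i \<in> {1..n} \<Longrightarrow> C i \<ge> 0 \<and> bnd (C i) i"
    by metis
  have "norm (q i t) \<le> ((\<Sum>i=1..n. C i) + 1) * (\<Sum>i=1..n. norm (q i 0)) * exp (- k * t)"
    if q: "chain_on n \<alpha> T q" "t \<in> {0..<T}" and i: "i \<in> {1..n}"
    for T t i and q :: "nat \<Rightarrow> real \<Rightarrow> complex"
  proof -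
    have "norm (q i t) = norm (chain_op n \<alpha> q (monom 1 (i - 1)) t)"
      using i by (subst chain_op_monom) auto
    also have "\<dots> \<le> C i * (\<Sum>i=1..n. norm (q i 0)) * exp (- k * t)"
      using C[OF i] q unfolding bnd_def by blast
    also have "C i \<le> (\<Sum>i=1..n. C i)"
      using C i by (intro member_le_sum) auto
    also have "\<dots> \<le> (\<Sum>i=1..n. C i) + 1" by simp
    finally show ?thesis by (auto simp: mult_right_mono sum_nonneg)
  qed
  moreover have "(\<Sum>i=1..n. C i) + 1 > 0"
    using C by (intro add_nonneg_pos sum_nonneg) auto
  ultimately show ?thesis using that k(1) by blast
qed

text \<open>Each real coordinate is embedded into the complex numbers, where the factorisation
  applies; reassembling them through the l1 norm costs the factor \<open>CARD('m)\<close>.\<close>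

lemma chain_decay:
  assumes "hurwitz (char_poly_of_gains n \<alpha>)"
  obtains C k where "C > 0" "k > 0"
    "\<And>T q t i. chain_on n \<alpha> T (q :: nat \<Rightarrow> real \<Rightarrow> real ^ 'm) \<Longrightarrow> t \<in> {0..<T} \<Longrightarrow> i \<in> {1..n} \<Longrightarrow>
       norm (q i t) \<le> C * (\<Sum>i=1..n. norm (q i 0)) * exp (- k * t)"
proof -
  obtain C k where C: "C > 0" "k > 0"
    "\<And>T q t i. chain_on n \<alpha> T (q :: nat \<Rightarrow> real \<Rightarrow> complex) \<Longrightarrow> t \<in> {0..<T} \<Longrightarrow> i \<in> {1..n} \<Longrightarrow>
       norm (q i t) \<le> C * (\<Sum>i=1..n. norm (q i 0)) * exp (- k * t)"
    using chain_decay_complex[OF assms] by blast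
  define C' where "C' = real CARD('m) * C"
  have "norm (q i t) \<le> C' * (\<Sum>i=1..n. norm (q i 0)) * exp (- k * t)"
    if q: "chain_on n \<alpha> T q" "t \<in> {0..<T}" and i: "i \<in> {1..n}"
    for T t i and q :: "nat \<Rightarrow> real \<Rightarrow> real ^ 'm"
  proof -
    have comp: "\<bar>q i t $ j\<bar> \<le> C * (\<Sum>i=1..n. norm (q i 0)) * exp (- k * t)" for j
    proof -
      have "bounded_linear (\<lambda>v :: real ^ 'm. complex_of_real (v $ j))"
        by (rule bounded_linear_compose[OF bounded_linear_of_real bounded_linear_vec_nth])
      from C(3)[OF chain_on_bounded_linear[OF this q(1)] q(2) i]
      have "\<bar>q i t $ j\<bar> \<le> C * (\<Sum>i=1..n. \<bar>q i 0 $ j\<bar>) * exp (- k * t)"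
        by simp
      also have "\<dots> \<le> C * (\<Sum>i=1..n. norm (q i 0)) * exp (- k * t)"
        using C(1) by (intro mult_right_mono mult_left_mono sum_mono component_le_norm_cart) auto
      finally show ?thesis .
    qed
    have "norm (q i t) \<le> (\<Sum>j\<in>UNIV. \<bar>q i t $ j\<bar>)" by (rule norm_le_l1_cart)
    also have "\<dots> \<le> (\<Sum>j\<in>(UNIV :: 'm set). C * (\<Sum>i=1..n. norm (q i 0)) * exp (- k * t))"
      by (intro sum_mono comp)
    also have "\<dots> = C' * (\<Sum>i=1..n. norm (q i 0)) * exp (- k * t)"
      by (simp add: C'_def)
    finally show ?thesis .
  qed
  moreover have "C' > 0" using C by (simp add: C'_def)
  ultimately show ?thesis using that C(2) by blast
qed

section \<open>Flows of globally Lipschitz fields\<close>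

text \<open>Gronwall for the squared distance, whose growth rate is at most
  \<open>2 * L\<close>.\<close>

lemma lipschitz_solutions_diverge:
  fixes f :: "'a::real_inner \<Rightarrow> 'a"
  assumes L: "\<And>x y. norm (f x - f y) \<le> L * norm (x - y)"
    and "solves_ode_on f {0..<T} x" "solves_ode_on f {0..<T} y" "t \<in> {0..<T}"
  shows "norm (x t - y t) \<le> norm (x 0 - y 0) * exp (L * t)"
proof -
  define h where "h = (\<lambda>t. (x t - y t) \<bullet> (x t - y t))"
  define h' where "h' = (\<lambda>t. 2 * ((x t - y t) \<bullet> (f (x t) - f (y t))))"
  have "(h has_vector_derivative h' t) (at t within {0..<T})" if "t \<in> {0..<T}" for t
  proof -
    have d: "((\<lambda>t. x t - y t) has_vector_derivative f (x t) - f (y t)) (at t within {0..<T})"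
      using assms(2,3) that unfolding solves_ode_on_def by (intro has_vector_derivative_diff) auto
    show ?thesis
      using bounded_bilinear.has_vector_derivative[OF bounded_bilinear_inner d d]
      by (simp add: h_def h'_def inner_commute)
  qed
  \<comment> \<open>The forcing is zero, so its nominal rate \<open>1 - 2 * L\<close> is any number
    above \<open>- 2 * L\<close>.\<close>
  moreover have "h' t \<le> - (- 2 * L) * h t + 0 * exp (- (1 - 2 * L) * t)" for t
  proof -
    have "(x t - y t) \<bullet> (f (x t) - f (y t)) \<le> norm (x t - y t) * norm (f (x t) - f (y t))"
      by (rule norm_cauchy_schwarz)
    also have "\<dots> \<le> norm (x t - y t) * (L * norm (x t - y t))"
      by (intro mult_left_mono L) auto
    also have "\<dots> = L * h t"
      by (simp add: h_def power2_norm_eq_inner[symmetric] power2_eq_square)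
    finally show ?thesis by (simp add: h'_def)
  qed
  ultimately have "h t \<le> (h 0 + 0 / ((1 - 2 * L) - - 2 * L)) * exp (- (- 2 * L) * t)"
    using assms(4) by (intro exp_decay_forced) auto
  also have "\<dots> = h 0 * (exp (L * t))\<^sup>2"
    by (simp add: power2_eq_square exp_add[symmetric])
  finally have "(norm (x t - y t))\<^sup>2 \<le> (norm (x 0 - y 0) * exp (L * t))\<^sup>2"
    by (simp add: h_def power2_norm_eq_inner power_mult_distrib)
  then show ?thesis by (rule power2_le_imp_le) simp
qed

lemma has_vector_derivative_integral_halfline:
  fixes g :: "real \<Rightarrow> 'a::banach"
  assumes "continuous_on {0..} g" "0 \<le> t"
  shows "((\<lambda>t. integral {0..t} g) has_vector_derivative g t) (at t within {0..})"
proof -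
  have "((\<lambda>t. integral {0..t} g) has_vector_derivative g t) (at t within {0..t + 1})"
    using assms by (intro integral_has_vector_derivative) (auto elim: continuous_on_subset)
  moreover have "at t within {0..t + 1} = at t within {0..}"
    by (rule at_within_nhd[of _ "{..<t + 1}"]) auto
  ultimately show ?thesis by simp
qed

lemma integral_exp_le:
  assumes "(k :: real) > 0" "0 \<le> t" "continuous_on {0..t} g"
    and "\<And>s. s \<in> {0..t} \<Longrightarrow> norm (g s :: 'a::banach) \<le> A * exp (k * s)" "0 \<le> A"
  shows "norm (integral {0..t} g) \<le> A / k * exp (k * t)"
proof -
  have hi: "((\<lambda>s. A * exp (k * s)) has_integral (A / k * exp (k * t) - A / k * exp (k * 0))) {0..t}"
    using assms(1,2) by (intro fundamental_theorem_of_calculus)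
      (auto intro!: derivative_eq_intros simp: has_real_derivative_iff_has_vector_derivative[symmetric])
  have "integral {0..t} (\<lambda>s. A * exp (k * s)) = A / k * exp (k * t) - A / k"
    using integral_unique[OF hi] by simp
  moreover have "(\<lambda>s. A * exp (k * s)) integrable_on {0..t}"
    using hi by (rule has_integral_integrable)
  moreover have "norm (integral {0..t} g) \<le> integral {0..t} (\<lambda>s. A * exp (k * s))"
    using assms by (intro integral_norm_bound_integral integrable_continuous_real continuous_intros) auto
  moreover have "0 \<le> A / k" using assms by simp
  ultimately show ?thesis by linarith
qed

text \<open>Picard iteration is a contraction on all of $[0,\infty)$ at once for the weighted unknown
  $u(t) = e^{-2Lt}(x(t) - x_0)$.\<close>

lemma lipschitz_solution_exists:
  fixes f :: "'a::banach \<Rightarrow> 'a"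
  assumes lip: "\<And>x y. norm (f x - f y) \<le> L * norm (x - y)" and L: "L > 0"
  shows "\<exists>x. x 0 = x0 \<and> solves_ode_on f {0..} x"
proof -
  have "continuous_on UNIV f"
    using lip L by (intro lipschitz_on_continuous_on[of L] lipschitz_onI) (auto simp: dist_norm)
  then have f_cont: "continuous_on S (\<lambda>s. f (y s))" if "continuous_on S y" for S and y :: "real \<Rightarrow> 'a"
    using that by (rule continuous_on_compose2) auto
  define F where "F = (\<lambda>(u :: real \<Rightarrow>\<^sub>C 'a) s. f (x0 + exp (2 * L * s) *\<^sub>R u s))"
  have F_cont: "continuous_on S (F u)" for u S
    unfolding F_def by (intro f_cont continuous_intros) auto
  \<comment> \<open>\<open>max 0 t\<close> extends the iterate constantly to negative times, which
    makes it a bounded continuous function on the whole line.\<close>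
  define G where "G = (\<lambda>u t. exp (- 2 * L * max 0 t) *\<^sub>R integral {0..max 0 t} (F u))"
  have I_cont: "continuous_on {0..} (\<lambda>t. integral {0..t} (F u))" for u
    using has_vector_derivative_integral_halfline[OF F_cont]
    by (intro has_vector_derivative_imp_continuous_on) auto
  have weight: "exp (- 2 * L * s) * (A / (2 * L) * exp (2 * L * s)) = A / (2 * L)" for s A
    by (simp add: exp_minus field_simps)
  have G_bcont: "G u \<in> bcontfun" for u
  proof (rule bcontfun_normI)
    show "continuous_on UNIV (G u)"
      unfolding G_def
      by (intro continuous_intros continuous_on_compose2[OF I_cont]) auto
    fix t
    define A where "A = norm (f x0) + L * norm u"
    have "norm (F u s) \<le> A * exp (2 * L * s)" if "0 \<le> s" for s
    proof -
      have "norm (F u s) \<le> norm (f x0) + norm (F u s - f x0)"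
        using norm_triangle_ineq[of "f x0" "F u s - f x0"] by simp
      also have "norm (F u s - f x0) \<le> L * norm (exp (2 * L * s) *\<^sub>R u s)"
        unfolding F_def by (rule order_trans[OF lip]) simp
      also have "\<dots> \<le> L * (exp (2 * L * s) * norm u)"
        using L norm_bounded[of u s] by simp
      also have "norm (f x0) \<le> norm (f x0) * exp (2 * L * s)"
        using L that mult_left_mono[of 1 "exp (2 * L * s)" "norm (f x0)"] by simp
      finally show ?thesis by (simp add: A_def algebra_simps)
    qed
    then have "norm (integral {0..max 0 t} (F u)) \<le> A / (2 * L) * exp (2 * L * max 0 t)"
      using L by (intro integral_exp_le F_cont) (auto simp: A_def)
    then have "norm (G u t) \<le> exp (- 2 * L * max 0 t) * (A / (2 * L) * exp (2 * L * max 0 t))"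
      unfolding G_def norm_scaleR abs_exp_cancel by (intro mult_left_mono) auto
    then show "norm (G u t) \<le> A / (2 * L)" unfolding weight .
  qed
  define H where "H = (\<lambda>u. Bcontfun (G u))"
  have H: "apply_bcontfun (H u) = G u" for u
    unfolding H_def using G_bcont by (simp add: Bcontfun_inverse)
  \<comment> \<open>Integrating the weight \<open>exp (2 * L * s)\<close> gains
    \<open>1 / (2 * L)\<close>, which against the Lipschitz factor \<open>L\<close> leaves one
    half.\<close>
  have contraction: "dist (H u) (H v) \<le> 1 / 2 * dist u v" for u v
  proof (rule dist_bound)
    fix t
    have "norm (F u s - F v s) \<le> L * dist u v * exp (2 * L * s)" for s
    proof -
      have "norm (F u s - F v s) \<le> L * norm (exp (2 * L * s) *\<^sub>R u s - exp (2 * L * s) *\<^sub>R v s)"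
        unfolding F_def by (rule order_trans[OF lip]) simp
      also have "\<dots> = L * (exp (2 * L * s) * dist (u s) (v s))"
        by (simp add: scaleR_diff_right[symmetric] dist_norm)
      also have "\<dots> \<le> L * (exp (2 * L * s) * dist u v)"
        using L dist_bounded[of u s v] by simp
      finally show ?thesis by (simp add: algebra_simps)
    qed
    then have "norm (integral {0..max 0 t} (\<lambda>s. F u s - F v s)) \<le>
        L * dist u v / (2 * L) * exp (2 * L * max 0 t)"
      using L by (intro integral_exp_le continuous_on_diff F_cont) auto
    then have "norm (G u t - G v t) \<le>
        exp (- 2 * L * max 0 t) * (L * dist u v / (2 * L) * exp (2 * L * max 0 t))"
      unfolding G_def scaleR_diff_right[symmetric]
      by (subst integral_diff[symmetric]) (auto intro!: integrable_continuous_real F_cont)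
    then show "dist (H u t) (H v t) \<le> 1 / 2 * dist u v"
      unfolding weight H dist_norm[of "G u t"] using L by simp
  qed
  have "\<exists>!u. H u = u"
    by (rule banach_fix_type[of "1 / 2"]) (use contraction in auto)
  then obtain u where u: "H u = u" by blast
  define x where "x = (\<lambda>t. x0 + integral {0..t} (F u))"
  have "F u t = f (x t)" if "0 \<le> t" for t
  proof -
    have "u t = exp (- 2 * L * t) *\<^sub>R integral {0..t} (F u)"
      using H[of u] that by (simp add: u G_def)
    then have "exp (2 * L * t) *\<^sub>R u t = integral {0..t} (F u)"
      by (simp add: exp_add[symmetric])
    then show ?thesis by (simp add: F_def x_def)
  qed
  moreover have "(x has_vector_derivative F u t) (at t within {0..})" if "0 \<le> t" for t
    unfolding x_def using has_vector_derivative_integral_halfline[OF F_cont that]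
    by (auto intro!: derivative_eq_intros)
  ultimately have "x 0 = x0" "solves_ode_on f {0..} x"
    by (auto simp: solves_ode_on_def x_def)
  then show ?thesis by blast
qed

lemma solves_ode_on_subset:
  assumes "solves_ode_on f S x" "U \<subseteq> S"
  shows "solves_ode_on f U x"
  using assms unfolding solves_ode_on_def
  by (blast intro: has_vector_derivative_within_subset)

text \<open>Joint continuity splits into a change of initial value, controlled by
  \<open>lipschitz_solutions_diverge\<close> locally uniformly in time, and motion along a single
  solution.\<close>

lemma lipschitz_flow:
  fixes f :: "'a::{banach, real_inner} \<Rightarrow> 'a"
  assumes lip: "\<And>x y. norm (f x - f y) \<le> L * norm (x - y)" and L: "L > 0"
  obtains \<phi> where "\<And>x. \<phi> 0 x = x" "\<And>x. solves_ode_on f {0..} (\<lambda>t. \<phi> t x)"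
    "continuous_on ({0..} \<times> UNIV) (\<lambda>(t, x). \<phi> t x)"
proof -
  have "\<forall>x. \<exists>\<xi>. \<xi> 0 = x \<and> solves_ode_on f {0..} \<xi>"
    using lipschitz_solution_exists[OF lip L] by blast
  then obtain \<psi> where \<psi>: "\<And>x. \<psi> x 0 = x" "\<And>x. solves_ode_on f {0..} (\<psi> x)"
    by metis
  have diverge: "norm (\<psi> x t - \<psi> y t) \<le> norm (x - y) * exp (L * t)" if "0 \<le> t" for x y t
  proof -
    have "solves_ode_on f {0..<t + 1} (\<psi> x)" for x
      by (rule solves_ode_on_subset[OF \<psi>(2)]) auto
    from lipschitz_solutions_diverge[OF lip this this, of t x y] that \<psi>(1)
    show ?thesis by simp
  qed
  have "continuous_on ({0..} \<times> UNIV) (\<lambda>(t, x). \<psi> x t)"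
    unfolding continuous_on_def
  proof clarify
    fix t :: real and x :: 'a assume "0 \<le> t"
    let ?F = "at (t, x) within {0..} \<times> UNIV"
    have fst_lim: "(fst \<longlongrightarrow> t) ?F" and snd_lim: "(snd \<longlongrightarrow> x) ?F"
      using tendsto_fst[OF tendsto_ident_at] tendsto_snd[OF tendsto_ident_at] by fastforce+
    have ev: "eventually (\<lambda>z. fst z \<in> {0..}) ?F"
      by (auto simp: eventually_at_filter intro!: always_eventually)
    have "continuous_on {0..} (\<psi> x)"
      using \<psi>(2)[of x] unfolding solves_ode_on_def
      by (intro has_vector_derivative_imp_continuous_on) auto
    then have "((\<lambda>z. \<psi> x (fst z)) \<longlongrightarrow> \<psi> x t) ?F"
      using \<open>0 \<le> t\<close> by (intro continuous_on_tendsto_compose[OF _ fst_lim _ ev]) auto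
    moreover have "((\<lambda>z. \<psi> (snd z) (fst z) - \<psi> x (fst z)) \<longlongrightarrow> 0) ?F"
    proof (rule Lim_null_comparison)
      show "eventually (\<lambda>z. norm (\<psi> (snd z) (fst z) - \<psi> x (fst z)) \<le>
          norm (snd z - x) * exp (L * fst z)) ?F"
        using ev by eventually_elim (auto intro: diverge)
      have "((\<lambda>z. norm (snd z - x) * exp (L * fst z)) \<longlongrightarrow> norm (x - x) * exp (L * t)) ?F"
        by (intro tendsto_intros fst_lim snd_lim)
      then show "((\<lambda>z. norm (snd z - x) * exp (L * fst z)) \<longlongrightarrow> 0) ?F" by simp
    qed
    ultimately have "((\<lambda>z. \<psi> x (fst z) + (\<psi> (snd z) (fst z) - \<psi> x (fst z))) \<longlongrightarrow> \<psi> x t + 0) ?F"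
      by (rule tendsto_add)
    then show "((\<lambda>(t, x). \<psi> x t) \<longlongrightarrow> \<psi> x t) ?F"
      by (simp add: case_prod_unfold)
  qed
  then show ?thesis using \<psi> that[of "\<lambda>t x. \<psi> x t"] by simp
qed

section \<open>Tracking a perturbed direction on the unit sphere\<close>

text \<open>Any inner product space is allowed: once the double cross product is expanded on the
  unit sphere, only inner products remain. The right-hand side is the tangential part of
  \<open>e - p\<close> at \<open>w\<close>.\<close>

locale sphere_tracking =
  fixes \<gamma> :: real and e :: "'a::real_inner" and p w :: "real \<Rightarrow> 'a"
  assumes gain_pos: "\<gamma> > 0" and norm_target: "norm e = 1"
    and norm_w: "\<And>t. t \<ge> 0 \<Longrightarrow> norm (w t) = 1"
    and w_derivative: "\<And>t. t \<ge> 0 \<Longrightarrow>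
      (w has_vector_derivative \<gamma> *\<^sub>R ((e - p t) - (w t \<bullet> (e - p t)) *\<^sub>R w t)) (at t within {0..})"
begin

text \<open>Restarting at a late time replaces \<open>p\<close> by its tail, which is how the
  smallness condition on \<open>M\<close> is reached for arbitrary data.\<close>

lemma shift:
  assumes "0 \<le> s"
  shows "sphere_tracking \<gamma> e (\<lambda>t. p (s + t)) (\<lambda>t. w (s + t))"
proof
  fix t :: real assume t: "t \<ge> 0"
  show "((\<lambda>t. w (s + t)) has_vector_derivative
      \<gamma> *\<^sub>R ((e - p (s + t)) - (w (s + t) \<bullet> (e - p (s + t))) *\<^sub>R w (s + t))) (at t within {0..})"
    using assms t by (intro has_vector_derivative_shift[OF w_derivative]) auto
qed (use gain_pos norm_target norm_w assms in auto)

lemma inner_self: "e \<bullet> e = 1" "t \<ge> 0 \<Longrightarrow> w t \<bullet> w t = 1"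
  using norm_target norm_w[of t] by (simp_all add: norm_eq_1)

lemma height_derivative:
  assumes "t \<ge> 0"
  shows "((\<lambda>t. w t \<bullet> e) has_vector_derivative
    \<gamma> * (1 - (w t \<bullet> e)\<^sup>2 - p t \<bullet> (e - (w t \<bullet> e) *\<^sub>R w t))) (at t within {0..})"
proof -
  have "((\<lambda>t. w t \<bullet> e) has_vector_derivative
      (\<gamma> *\<^sub>R ((e - p t) - (w t \<bullet> (e - p t)) *\<^sub>R w t)) \<bullet> e) (at t within {0..})"
    by (rule bounded_linear.has_vector_derivative[OF bounded_linear_inner_left w_derivative[OF assms]])
  moreover have "(\<gamma> *\<^sub>R ((e - p t) - (w t \<bullet> (e - p t)) *\<^sub>R w t)) \<bullet> e =
      \<gamma> * (1 - (w t \<bullet> e)\<^sup>2 - p t \<bullet> (e - (w t \<bullet> e) *\<^sub>R w t))"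
    using inner_self by (simp add: inner_diff inner_commute power2_eq_square algebra_simps)
  ultimately show ?thesis by (simp only:)
qed

lemma norm_tangent:
  assumes "t \<ge> 0"
  shows "(norm (e - (w t \<bullet> e) *\<^sub>R w t))\<^sup>2 = 1 - (w t \<bullet> e)\<^sup>2"
  unfolding power2_norm_eq_inner using inner_self(1) inner_self(2)[OF assms]
  by (simp add: inner_diff inner_commute power2_eq_square algebra_simps)

lemma height_bounds:
  assumes "t \<ge> 0"
  shows "\<bar>w t \<bullet> e\<bar> \<le> 1"
  using Cauchy_Schwarz_ineq2[of "w t" e] norm_target norm_w[OF assms] by simp

lemma distance_height:
  assumes "t \<ge> 0"
  shows "(norm (e - w t))\<^sup>2 = 2 * (1 - w t \<bullet> e)" "(norm (- e - w t))\<^sup>2 = 2 * (1 + w t \<bullet> e)"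
  using inner_self(1) inner_self(2)[OF assms]
  by (simp_all add: power2_norm_eq_inner inner_diff inner_commute algebra_simps)

text \<open>The restoring term never lowers the height, so the loss is at most the total push
  \<open>\<gamma> * M / k \<le> \<delta>\<close>; of an initial \<open>2 * \<delta>\<close> at least
  \<open>\<delta>\<close> is left.\<close>

lemma height_remains:
  assumes p: "\<And>t. t \<ge> 0 \<Longrightarrow> norm (p t) \<le> M * exp (- k * t)" and k: "k > 0"
    and M: "\<gamma> * M \<le> k * \<delta>" "2 * \<delta> \<le> 1 + w 0 \<bullet> e" and t: "t \<ge> 0"
  shows "\<delta> \<le> 1 + w t \<bullet> e"
proof -
  \<comment> \<open>The exponential term bounds the push still to come after time
    \<open>t\<close>.\<close>
  define h where "h = (\<lambda>t. \<gamma> * M / k * exp (- k * t) - w t \<bullet> e)"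
  define h' where "h' = (\<lambda>t. - (\<gamma> * M * exp (- k * t)) -
    \<gamma> * (1 - (w t \<bullet> e)\<^sup>2 - p t \<bullet> (e - (w t \<bullet> e) *\<^sub>R w t)))"
  have "(h has_vector_derivative h' s) (at s within {0..<t + 1})" if "s \<in> {0..<t + 1}" for s
  proof -
    have "((\<lambda>t. w t \<bullet> e) has_vector_derivative
      \<gamma> * (1 - (w s \<bullet> e)\<^sup>2 - p s \<bullet> (e - (w s \<bullet> e) *\<^sub>R w s))) (at s within {0..<t + 1})"
      using that by (intro has_vector_derivative_within_subset[OF height_derivative]) auto
    then show ?thesis
      unfolding h_def h'_def using k
      by (intro has_vector_derivative_diff)
        (auto intro!: derivative_eq_intros simp: has_real_derivative_iff_has_vector_derivative[symmetric])
  qed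
  moreover have "h' s \<le> 0" if "s \<in> {0..<t + 1}" for s
  proof -
    have s: "s \<ge> 0" using that by simp
    have "norm (e - (w s \<bullet> e) *\<^sub>R w s) \<le> 1"
      by (rule power2_le_imp_le) (auto simp: norm_tangent[OF s])
    then have "norm (p s) * norm (e - (w s \<bullet> e) *\<^sub>R w s) \<le> M * exp (- k * s) * 1"
      using p[OF s] by (intro mult_mono) (auto intro: order_trans[OF norm_ge_zero])
    moreover have "(w s \<bullet> e)\<^sup>2 \<le> 1"
      using height_bounds[OF s] by (simp add: abs_square_le_1)
    ultimately have "\<gamma> * (p s \<bullet> (e - (w s \<bullet> e) *\<^sub>R w s) - (1 - (w s \<bullet> e)\<^sup>2)) \<le> \<gamma> * (M * exp (- k * s))"
      using gain_pos norm_cauchy_schwarz[of "p s" "e - (w s \<bullet> e) *\<^sub>R w s"]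
      by (intro mult_left_mono) auto
    then show ?thesis by (simp add: h'_def algebra_simps)
  qed
  ultimately have "h t \<le> h 0"
    using t by (intro nonincreasing_on_halfopen[where h = h and h' = h' and T = "t + 1"]) auto
  moreover have "0 \<le> \<gamma> * M / k * exp (- k * t)"
  proof -
    have "0 \<le> M" using p[of 0] order_trans[OF norm_ge_zero] by force
    then show ?thesis using gain_pos k by simp
  qed
  moreover have "\<gamma> * M / k \<le> \<delta>" using M(1) k by (simp add: field_simps)
  ultimately show ?thesis using M(2) by (simp add: h_def)
qed

text \<open>For the tangential part v of \<open>e\<close>, the defect 1 - w.e has derivative
  -\<gamma>(|v|^2 - p.v), and |v|^2 = (1 - w.e)(1 + w.e) is at least \<delta> times the defect.
  Young's inequality spends half of |v|^2 on the perturbation: this leaves the rate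
  \<open>\<gamma> * \<delta> / 2\<close> and a forcing quadratic in p, whence the comparison with
  \<open>2 * k\<close>.\<close>

lemma tracking_rate:
  assumes p: "\<And>t. t \<ge> 0 \<Longrightarrow> norm (p t) \<le> M * exp (- k * t)" and k: "k > 0"
    and M: "\<gamma> * M \<le> k * \<delta>" "2 * \<delta> \<le> 1 + w 0 \<bullet> e" and \<mu>: "\<gamma> * \<delta> / 2 < 2 * k" and t: "t \<ge> 0"
  shows "(norm (e - w t))\<^sup>2 \<le>
    ((norm (e - w 0))\<^sup>2 + \<gamma> * M\<^sup>2 / (2 * k - \<gamma> * \<delta> / 2)) * exp (- (\<gamma> * \<delta> / 2) * t)"
proof -
  define h where "h = (\<lambda>t. 1 - w t \<bullet> e)"
  define h' where "h' = (\<lambda>t. - (\<gamma> * (1 - (w t \<bullet> e)\<^sup>2 - p t \<bullet> (e - (w t \<bullet> e) *\<^sub>R w t))))"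
  have "(h has_vector_derivative h' s) (at s within {0..<t + 1})" if "s \<in> {0..<t + 1}" for s
  proof -
    have "((\<lambda>t. w t \<bullet> e) has_vector_derivative
      \<gamma> * (1 - (w s \<bullet> e)\<^sup>2 - p s \<bullet> (e - (w s \<bullet> e) *\<^sub>R w s))) (at s within {0..<t + 1})"
      using that by (intro has_vector_derivative_within_subset[OF height_derivative]) auto
    then show ?thesis
      unfolding h_def h'_def by (auto intro!: derivative_eq_intros)
  qed
  moreover have "h' s \<le> - (\<gamma> * \<delta> / 2) * h s + \<gamma> * M\<^sup>2 / 2 * exp (- (2 * k) * s)"
    if "s \<in> {0..<t + 1}" for s
  proof -
    have s: "s \<ge> 0" using that by simp
    define v where "v = e - (w s \<bullet> e) *\<^sub>R w s"
    have v: "(norm v)\<^sup>2 = h s * (1 + w s \<bullet> e)"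
      using norm_tangent[OF s] by (simp add: v_def h_def power2_eq_square algebra_simps)
    have "h s \<ge> 0" using height_bounds[OF s] by (simp add: h_def)
    then have "h s * \<delta> \<le> (norm v)\<^sup>2"
      unfolding v using height_remains[OF p k M s] by (intro mult_left_mono) auto
    moreover have "p s \<bullet> v \<le> (norm (p s))\<^sup>2 / 2 + (norm v)\<^sup>2 / 2"
    proof -
      have "0 \<le> (norm (p s) - norm v)\<^sup>2" by simp
      then show ?thesis
        using norm_cauchy_schwarz[of "p s" v] by (simp add: power2_diff)
    qed
    moreover have "(norm (p s))\<^sup>2 \<le> M\<^sup>2 * exp (- (2 * k) * s)"
    proof -
      have "(norm (p s))\<^sup>2 \<le> (M * exp (- k * s))\<^sup>2"
        by (intro power_mono p s) simp
      then show ?thesis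
        by (simp add: power_mult_distrib power2_eq_square[of "exp _"] exp_add[symmetric] mult.assoc)
    qed
    moreover have "h' s = - \<gamma> * ((norm v)\<^sup>2 - p s \<bullet> v)"
      by (simp add: h'_def v_def norm_tangent[OF s])
    moreover have "(norm v)\<^sup>2 - p s \<bullet> v \<ge> h s * \<delta> / 2 - M\<^sup>2 * exp (- (2 * k) * s) / 2"
      using calculation by argo
    then have "\<gamma> * ((norm v)\<^sup>2 - p s \<bullet> v) \<ge> \<gamma> * (h s * \<delta> / 2 - M\<^sup>2 * exp (- (2 * k) * s) / 2)"
      using gain_pos by (intro mult_left_mono) auto
    ultimately show ?thesis by (simp add: algebra_simps)
  qed
  ultimately have "h t \<le> (h 0 + \<gamma> * M\<^sup>2 / 2 / (2 * k - \<gamma> * \<delta> / 2)) * exp (- (\<gamma> * \<delta> / 2) * t)"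
    using t \<mu> gain_pos by (intro exp_decay_forced[where h' = h' and T = "t + 1"]) auto
  then have "2 * h t \<le> 2 * ((h 0 + \<gamma> * M\<^sup>2 / 2 / (2 * k - \<gamma> * \<delta> / 2)) * exp (- (\<gamma> * \<delta> / 2) * t))"
    by simp
  also have "\<dots> = (2 * h 0 + \<gamma> * M\<^sup>2 / (2 * k - \<gamma> * \<delta> / 2)) * exp (- (\<gamma> * \<delta> / 2) * t)"
  proof -
    have "2 * ((a + b / 2 / c) * d) = (2 * a + b / c) * d" for a b c d :: real
      by (simp add: algebra_simps)
    then show ?thesis .
  qed
  finally show ?thesis using t by (simp only: distance_height h_def order_refl)
qed

lemma tracks_target:
  assumes p: "\<And>t. t \<ge> 0 \<Longrightarrow> norm (p t) \<le> M * exp (- k * t)" and k: "k > 0"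
    and M: "\<gamma> * M \<le> k * \<delta>" "2 * \<delta> \<le> 1 + w 0 \<bullet> e" and \<mu>: "\<gamma> * \<delta> / 2 < 2 * k" and \<delta>: "\<delta> > 0"
  shows "(w \<longlongrightarrow> e) at_top"
proof -
  define A where "A = (norm (e - w 0))\<^sup>2 + \<gamma> * M\<^sup>2 / (2 * k - \<gamma> * \<delta> / 2)"
  define \<mu> where "\<mu> = \<gamma> * \<delta> / 2"
  have pos: "\<mu> > 0" using gain_pos \<delta> by (simp add: \<mu>_def)
  have "((\<lambda>t. (norm (e - w t))\<^sup>2) \<longlongrightarrow> 0) at_top"
  proof (rule Lim_null_comparison)
    show "eventually (\<lambda>t. norm ((norm (e - w t))\<^sup>2) \<le> A * exp (- \<mu> * t)) at_top"
      using eventually_ge_at_top[of 0]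
      by eventually_elim (use tracking_rate[OF p k M \<open>\<gamma> * \<delta> / 2 < 2 * k\<close>] in \<open>simp add: A_def \<mu>_def\<close>)
  qed (rule exp_decay_tendsto_0[OF pos])
  then have "((\<lambda>t. sqrt ((norm (e - w t))\<^sup>2)) \<longlongrightarrow> sqrt 0) at_top"
    by (rule tendsto_real_sqrt)
  then have "((\<lambda>t. norm (e - w t)) \<longlongrightarrow> 0) at_top" by simp
  then have "((\<lambda>t. e - w t) \<longlongrightarrow> 0) at_top"
    by (rule tendsto_norm_zero_cancel)
  from tendsto_diff[OF tendsto_const[of e] this] show ?thesis by simp
qed

text \<open>If \<open>w\<close> does not tend to \<open>- e\<close>, its height exceeds some fixed
  \<epsilon> at arbitrarily late times; at one of them the tail of \<open>p\<close> is small enough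
  for \<open>tracks_target\<close> to apply from there on.\<close>

lemma tracks_target_or_antipode:
  assumes p: "\<And>t. t \<ge> 0 \<Longrightarrow> norm (p t) \<le> M * exp (- k * t)" and k: "k > 0"
  shows "(w \<longlongrightarrow> e) at_top \<or> (w \<longlongrightarrow> - e) at_top"
proof (rule disjCI)
  assume not_antipode: "\<not> (w \<longlongrightarrow> - e) at_top"
  have "\<not> ((\<lambda>t. sqrt (2 * (1 + w t \<bullet> e))) \<longlongrightarrow> 0) at_top"
  proof
    assume lim: "((\<lambda>t. sqrt (2 * (1 + w t \<bullet> e))) \<longlongrightarrow> 0) at_top"
    have "eventually (\<lambda>t. sqrt (2 * (1 + w t \<bullet> e)) = norm (- e - w t)) at_top"
      using eventually_ge_at_top[of 0]
      by eventually_elim (simp only: distance_height(2)[symmetric] real_sqrt_abs abs_norm_cancel)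
    with lim have "((\<lambda>t. norm (- e - w t)) \<longlongrightarrow> 0) at_top"
      by (simp cong: tendsto_cong)
    then have "((\<lambda>t. - e - w t) \<longlongrightarrow> 0) at_top"
      by (rule tendsto_norm_zero_cancel)
    from tendsto_diff[OF tendsto_const[of "- e"] this] not_antipode show False by simp
  qed
  then have "\<not> ((\<lambda>t. 1 + w t \<bullet> e) \<longlongrightarrow> 0) at_top"
    using tendsto_real_sqrt[OF tendsto_mult_left, of _ 0 at_top 2] by force
  then obtain \<epsilon> where \<epsilon>: "\<epsilon> > 0" "\<not> eventually (\<lambda>t. \<bar>1 + w t \<bullet> e\<bar> < \<epsilon>) at_top"
    unfolding tendsto_iff dist_real_def by auto
  \<comment> \<open>\<open>\<epsilon> / 2\<close> provides the height margin
    \<open>2 * \<delta>\<close>; \<open>k / \<gamma>\<close> secures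
    \<open>\<gamma> * \<delta> / 2 < 2 * k\<close>.\<close>
  define \<delta> where "\<delta> = min (\<epsilon> / 2) (k / \<gamma>)"
  have \<delta>: "\<delta> > 0" "2 * \<delta> \<le> \<epsilon>" using \<epsilon> k gain_pos by (auto simp: \<delta>_def)
  have "\<gamma> * \<delta> \<le> \<gamma> * (k / \<gamma>)"
    using gain_pos by (intro mult_left_mono) (auto simp: \<delta>_def)
  then have \<mu>: "\<gamma> * \<delta> / 2 < 2 * k" using gain_pos k by simp
  have "((\<lambda>t. \<gamma> * (M * exp (- k * t))) \<longlongrightarrow> \<gamma> * 0) at_top"
    by (intro tendsto_mult_left exp_decay_tendsto_0 k)
  then have "eventually (\<lambda>t. \<gamma> * (M * exp (- k * t)) < k * \<delta>) at_top"
    using \<delta> k by (intro order_tendstoD) auto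
  with eventually_ge_at_top[of 0]
  have "eventually (\<lambda>t. 0 \<le> t \<and> \<gamma> * (M * exp (- k * t)) < k * \<delta>) at_top"
    by (rule eventually_conj)
  moreover have "frequently (\<lambda>t. \<not> \<bar>1 + w t \<bullet> e\<bar> < \<epsilon>) at_top"
    using \<epsilon>(2) by (simp add: frequently_def)
  ultimately
  have "frequently (\<lambda>t. \<not> \<bar>1 + w t \<bullet> e\<bar> < \<epsilon> \<and> 0 \<le> t \<and> \<gamma> * (M * exp (- k * t)) < k * \<delta>) at_top"
    using frequently_eventually_frequently by blast
  from frequently_ex[OF this]
  obtain s where s: "0 \<le> s" "\<gamma> * (M * exp (- k * s)) < k * \<delta>" "\<not> \<bar>1 + w s \<bullet> e\<bar> < \<epsilon>"
    by blast
  have height: "2 * \<delta> \<le> 1 + w s \<bullet> e"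
    using s(3) \<delta>(2) height_bounds[OF s(1)] by simp
  interpret shifted: sphere_tracking \<gamma> e "\<lambda>t. p (s + t)" "\<lambda>t. w (s + t)"
    using s(1) by (rule shift)
  have "((\<lambda>t. w (s + t)) \<longlongrightarrow> e) at_top"
  proof (rule shifted.tracks_target[OF _ k _ _ \<mu> \<delta>(1)])
    show "norm (p (s + t)) \<le> M * exp (- k * s) * exp (- k * t)" if "t \<ge> 0" for t
      using p[of "s + t"] that s(1) by (simp add: exp_add[symmetric] algebra_simps)
  qed (use s height in auto)
  then show "(w \<longlongrightarrow> e) at_top" by (rule tendsto_at_top_shiftD)
qed

end

text \<open>The defect $1 - w \cdot w'$ between two solutions driven by the same perturbation grows at
  rate $-\gamma (e - p)\cdot(w + w')$, which tends to $2\gamma$ if both approach $-e$.\<close>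

lemma sphere_tracking_antipode_unique:
  assumes "sphere_tracking \<gamma> e p w" "sphere_tracking \<gamma> e p w'"
    and p: "\<And>t. t \<ge> 0 \<Longrightarrow> norm (p t) \<le> M" "(p \<longlongrightarrow> 0) at_top"
    and lim: "(w \<longlongrightarrow> - e) at_top" "(w' \<longlongrightarrow> - e) at_top"
  shows "w 0 = w' 0"
proof -
  interpret w: sphere_tracking \<gamma> e p w by fact
  interpret w': sphere_tracking \<gamma> e p w' by fact
  define h where "h = (\<lambda>t. w t \<bullet> w' t - 1)"
  define c where "c = (\<lambda>t. (e - p t) \<bullet> (w t + w' t))"
  have h_der: "(h has_vector_derivative - (\<gamma> * c t) * h t) (at t within {0..})" if "t \<ge> 0" for t
  proof -
    have "((\<lambda>t. w t \<bullet> w' t) has_vector_derivative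
       w t \<bullet> (\<gamma> *\<^sub>R ((e - p t) - (w' t \<bullet> (e - p t)) *\<^sub>R w' t)) +
       (\<gamma> *\<^sub>R ((e - p t) - (w t \<bullet> (e - p t)) *\<^sub>R w t)) \<bullet> w' t) (at t within {0..})"
      using bounded_bilinear.has_vector_derivative[OF bounded_bilinear_inner
          w.w_derivative[OF that] w'.w_derivative[OF that]] by simp
    moreover have "w t \<bullet> (\<gamma> *\<^sub>R ((e - p t) - (w' t \<bullet> (e - p t)) *\<^sub>R w' t)) +
       (\<gamma> *\<^sub>R ((e - p t) - (w t \<bullet> (e - p t)) *\<^sub>R w t)) \<bullet> w' t = - (\<gamma> * c t) * h t"
      by (simp add: h_def c_def inner_diff inner_add inner_commute algebra_simps)
    ultimately show ?thesis unfolding h_def by (auto intro!: derivative_eq_intros)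
  qed
  have h_le: "h t \<le> 0" and h_ge: "h t \<ge> - 2" if "t \<ge> 0" for t
    using Cauchy_Schwarz_ineq2[of "w t" "w' t"] w.norm_w[OF that] w'.norm_w[OF that]
    by (auto simp: h_def)
  have growth: "h (s + t) \<le> h s * exp (- \<mu> * t)"
    if s: "s \<ge> 0" and t: "t \<ge> 0" and c: "\<And>t. t \<ge> s \<Longrightarrow> \<gamma> * c t \<le> \<mu>" for s t \<mu>
  proof -
    have "((\<lambda>t. h (s + t)) has_vector_derivative - (\<gamma> * c (s + u)) * h (s + u)) (at u within {0..<t + 1})"
      if u: "u \<in> {0..<t + 1}" for u
      using s u by (intro has_vector_derivative_shift[OF h_der]) auto
    moreover have "- (\<gamma> * c (s + u)) * h (s + u) \<le> - \<mu> * h (s + u) + 0 * exp (- (\<mu> + 1) * u)"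
      if "u \<in> {0..<t + 1}" for u
      using mult_right_mono_neg[of "\<gamma> * c (s + u)" \<mu> "h (s + u)"] c[of "s + u"] h_le[of "s + u"] s that
      by auto
    ultimately have "h (s + t) \<le> (h (s + 0) + 0 / (\<mu> + 1 - \<mu>)) * exp (- \<mu> * t)"
      using t by (intro exp_decay_forced[where T = "t + 1"]) auto
    then show ?thesis by simp
  qed
  have "(c \<longlongrightarrow> (e - 0) \<bullet> (- e + - e)) at_top"
    unfolding c_def by (intro tendsto_intros p lim)
  then have "(c \<longlongrightarrow> - 2) at_top"
    using w.inner_self(1) by (simp add: inner_diff_right)
  then have "eventually (\<lambda>t. c t < - 1) at_top"
    by (rule order_tendstoD) simp
  then obtain N where "\<And>t. t \<ge> N \<Longrightarrow> c t < - 1"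
    by (auto simp: eventually_at_top_linorder)
  then obtain s where s: "s \<ge> 0" "\<And>t. t \<ge> s \<Longrightarrow> c t < - 1"
    by (metis max.bounded_iff max.cobounded1 max.cobounded2)
  \<comment> \<open>After \<open>s\<close> a negative \<open>h\<close> would be driven down at least
    like \<open>exp (\<gamma> * t)\<close> and leave the range \<open>h \<ge> - 2\<close>.\<close>
  have "h s = 0"
  proof (rule ccontr)
    assume "h s \<noteq> 0"
    then have "h s < 0" using h_le[OF s(1)] by simp
    have \<gamma>c: "\<gamma> * c t \<le> - \<gamma>" if "t \<ge> s" for t
      using mult_left_mono[of "c t" "- 1" \<gamma>] s(2)[OF that] w.gain_pos by simp
    have "- 2 \<le> h s * (1 + \<gamma> * t)" if "t \<ge> 0" for t
    proof -
      have "- 2 \<le> h (s + t)" using h_ge s that by simp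
      also have "\<dots> \<le> h s * exp (\<gamma> * t)" using growth[OF s(1) that \<gamma>c] by simp
      also have "\<dots> \<le> h s * (1 + \<gamma> * t)"
        using \<open>h s < 0\<close> by (intro mult_left_mono_neg exp_ge_add_one_self) auto
      finally show ?thesis .
    qed
    \<comment> \<open>The time at which the linear bound \<open>h s * (1 + \<gamma> * t)\<close> has
      fallen to \<open>h s - 2\<close>.\<close>
    moreover have "0 \<le> - 2 / h s / \<gamma>"
      using \<open>h s < 0\<close> w.gain_pos by (simp add: divide_nonpos_neg mult_nonpos_nonneg)
    moreover have "h s * (1 + \<gamma> * (- 2 / h s / \<gamma>)) = h s - 2"
      using \<open>h s < 0\<close> w.gain_pos by (simp add: field_simps)
    ultimately show False using \<open>h s < 0\<close> by fastforce
  qed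
  \<comment> \<open>Back to time 0: with a crude bound on \<open>c\<close> valid at all times,
    \<open>h\<close> cannot climb from a negative value to 0 in finite time.\<close>
  moreover have "h s \<le> h 0 * exp (- (\<gamma> * ((1 + M) * 2)) * s)"
  proof -
    have "\<gamma> * c t \<le> \<gamma> * ((1 + M) * 2)" if "t \<ge> 0" for t
    proof -
      have "c t \<le> norm (e - p t) * norm (w t + w' t)"
        unfolding c_def by (rule norm_cauchy_schwarz)
      also have "\<dots> \<le> (1 + M) * 2"
      proof (rule mult_mono)
        show "norm (e - p t) \<le> 1 + M"
          using norm_triangle_ineq4[of e "p t"] p(1)[OF that] w.norm_target by simp
        show "norm (w t + w' t) \<le> 2"
          using norm_triangle_ineq[of "w t" "w' t"] w.norm_w[OF that] w'.norm_w[OF that] by simp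
        show "0 \<le> 1 + M" using p(1)[OF that] order_trans[OF norm_ge_zero] by fastforce
      qed auto
      finally show ?thesis using w.gain_pos by simp
    qed
    from growth[OF order_refl s(1) this] show ?thesis by simp
  qed
  ultimately have "h 0 \<ge> 0" by (simp add: zero_le_mult_iff)
  then have "w 0 \<bullet> w' 0 = 1" using h_le[of 0] by (simp add: h_def)
  then have "(norm (w 0 - w' 0))\<^sup>2 = 0"
    using w.inner_self(2)[of 0] w'.inner_self(2)[of 0]
    by (simp add: power2_norm_eq_inner inner_diff inner_commute)
  then show ?thesis by simp
qed

section \<open>The cascade as a dynamical system\<close>

lemma norm_proj: "norm (fst z) \<le> norm z" "norm (snd z) \<le> norm z"
  for z :: "'a::real_normed_vector \<times> 'b::real_normed_vector"
  using norm_fst_le[of "fst z" "snd z"] norm_snd_le[of "snd z" "fst z"] by simp_all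

lemma norm_cross3_le: "norm (cross3 x y) \<le> norm x * norm y"
proof (rule power2_le_imp_le)
  show "(norm (cross3 x y))\<^sup>2 \<le> (norm x * norm y)\<^sup>2"
    using norm_cross_dot[of x y] zero_le_power2[of "x \<bullet> y"] by linarith
qed simp

lemma double_cross3_lipschitz:
  assumes "norm w \<le> 1" "norm w' \<le> 1" "norm u \<le> B"
  shows "norm (cross3 w (cross3 w u) - cross3 w' (cross3 w' u')) \<le> 2 * B * norm (w - w') + norm (u - u')"
proof -
  have "cross3 w (cross3 w u) - cross3 w' (cross3 w' u') =
      cross3 (w - w') (cross3 w u) + cross3 w' (cross3 (w - w') u) + cross3 w' (cross3 w' (u - u'))"
    by (simp add: Cross3.left_diff_distrib Cross3.right_diff_distrib)
  also have "norm \<dots> \<le> norm (cross3 (w - w') (cross3 w u)) + norm (cross3 w' (cross3 (w - w') u)) +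
      norm (cross3 w' (cross3 w' (u - u')))"
    by (intro norm_triangle_le add_mono) auto
  also have "norm (cross3 (w - w') (cross3 w u)) \<le> norm (w - w') * (1 * B)"
    using assms by (intro order_trans[OF norm_cross3_le] mult_mono) auto
  also have "norm (cross3 w' (cross3 (w - w') u)) \<le> 1 * (norm (w - w') * B)"
    using assms by (intro order_trans[OF norm_cross3_le] mult_mono) auto
  also have "norm (cross3 w' (cross3 w' (u - u'))) \<le> 1 * (1 * norm (u - u'))"
    using assms by (intro order_trans[OF norm_cross3_le] mult_mono) auto
  finally show ?thesis by (simp add: algebra_simps)
qed

text \<open>For \<open>R > 0\<close> this is the radial retraction onto the closed ball of radius
  \<open>R\<close>. Being multiplication by a scalar, it preserves orthogonality to
  \<open>v\<close>.\<close>

definition clip :: "real \<Rightarrow> 'a::real_normed_vector \<Rightarrow> 'a" where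
  "clip R v = (R / max R (norm v)) *\<^sub>R v"

lemma clip_id: "0 < R \<Longrightarrow> norm v \<le> R \<Longrightarrow> clip R v = v"
  by (simp add: clip_def)

lemma norm_clip_le: "0 < R \<Longrightarrow> norm (clip R v) \<le> R"
  by (simp add: clip_def field_simps max_def)

text \<open>The constant 2 holds in every normed space: one unit for the change of vector at a fixed
  scale, one for the change of scale.\<close>

lemma clip_lipschitz:
  assumes "0 < R"
  shows "norm (clip R v - clip R v') \<le> 2 * norm (v - v')"
proof -
  define m m' where "m = max R (norm v)" and "m' = max R (norm v')"
  have m: "0 < m" "R \<le> m" "0 < m'" "norm v' \<le> m'" using assms by (auto simp: m_def m'_def)
  have mm': "\<bar>m' - m\<bar> \<le> norm (v - v')"
    using norm_triangle_ineq2[of v v'] norm_triangle_ineq2[of v' v]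
    by (auto simp: m_def m'_def max_def norm_minus_commute)
  have "clip R v - clip R v' = (R / m) *\<^sub>R (v - v') + ((R / m) * ((m' - m) / m')) *\<^sub>R v'"
  proof -
    have "(R / m) * ((m' - m) / m') = R / m - R / m'"
      using m by (simp add: field_simps)
    then show ?thesis
      by (simp add: clip_def m_def[symmetric] m'_def[symmetric] scaleR_diff_left scaleR_diff_right)
  qed
  also have "norm \<dots> \<le> norm ((R / m) *\<^sub>R (v - v')) + norm (((R / m) * ((m' - m) / m')) *\<^sub>R v')"
    by (rule norm_triangle_ineq)
  also have "\<dots> = (R / m) * norm (v - v') + (R / m) * (\<bar>m' - m\<bar> * (norm v' / m'))"
    using assms m by (simp add: abs_mult)
  also have "\<dots> \<le> 1 * norm (v - v') + 1 * (norm (v - v') * 1)"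
    using assms m mm' by (intro add_mono mult_mono) auto
  finally show ?thesis by simp
qed

section \<open>The cascade, its a priori bounds and its truncation\<close>

locale E_system =
  fixes n :: nat and idx :: "nat \<Rightarrow> 'n::finite"
    and \<alpha> :: "nat \<Rightarrow> real" and \<gamma> :: real and e :: "real ^ 3"
  assumes n: "n \<ge> 2" and bij: "bij_betw idx {1..n} (UNIV :: 'n set)"
    and \<gamma>: "\<gamma> > 0" and \<alpha>: "\<forall>i\<in>{1..n}. \<alpha> i > 0"
    and hurwitz: "hurwitz (char_poly_of_gains n \<alpha>)" and e: "norm e = 1"
begin

abbreviation "E \<equiv> E_field n idx \<alpha> \<gamma> e"

text \<open>The zeros fill the slots of the gain, the centre and \<open>z2\<close>, which enter only
  the second component of the field.\<close>

definition chain_field :: "(real ^ 3) ^ 'n \<Rightarrow> (real ^ 3) ^ 'n" where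
  "chain_field zp = fst (E_field n idx \<alpha> 0 0 (zp, 0))"

text \<open>\<open>z2 - zp $ idx 1\<close> and \<open>e - zp $ idx 1\<close> differ by
  \<open>e - z2\<close>, which the cross product with \<open>e - z2\<close> annihilates.\<close>

lemma E_eq:
  "E x = (chain_field (fst x), \<gamma> *\<^sub>R cross3 (e - snd x) (cross3 (e - snd x) (e - fst x $ idx 1)))"
proof -
  obtain zp z2 where x: "x = (zp, z2)" by (cases x)
  have "z2 - zp $ idx 1 = (e - zp $ idx 1) - (e - z2)" by simp
  then have "cross3 (e - z2) (z2 - zp $ idx 1) = cross3 (e - z2) (e - zp $ idx 1)"
    by (simp only: Cross3.right_diff_distrib cross_refl diff_zero)
  then show ?thesis
    by (simp add: x chain_field_def E_field_def matrix_vector_mul_assoc[symmetric] skew_mult)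
qed

lemma linear_chain_field: "linear chain_field"
  by (rule linearI) (simp_all add: chain_field_def E_field_def vec_eq_iff sum.distrib
      scaleR_add_right scaleR_sum_right sum_distrib_left algebra_simps)

text \<open>Stated for every field with this first component, so that the original and the truncated
  system share the same estimates.\<close>

lemma chain_solution:
  assumes "solves_ode_on f {0..<T} \<xi>" "\<And>x. fst (f x) = chain_field (fst x)"
  shows "chain_on n \<alpha> T (\<lambda>i t. fst (\<xi> t) $ idx i)"
proof -
  have der: "((\<lambda>t. fst (\<xi> t) $ idx i) has_vector_derivative chain_field (fst (\<xi> t)) $ idx i)
      (at t within {0..<T})" if "t \<in> {0..<T}" for t i
  proof -
    have "bounded_linear (\<lambda>x. fst x $ idx i)"
      by (rule bounded_linear_compose[OF bounded_linear_vec_nth bounded_linear_fst])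
    from bounded_linear.has_vector_derivative[OF this, of \<xi> "f (\<xi> t)"] show ?thesis
      using assms that by (auto simp: solves_ode_on_def)
  qed
  have chain: "chain_field zp $ idx i = zp $ idx (Suc i)" if "i \<in> {1..<n}" for zp i
    using E_field_chain[OF bij that] by (simp add: chain_field_def)
  have last: "chain_field zp $ idx n = - (\<Sum>i=1..n. \<alpha> i *\<^sub>R zp $ idx i)" for zp
    using E_field_last by (simp add: chain_field_def)
  show ?thesis
    unfolding chain_on_def
  proof (intro ballI conjI)
    fix t i assume t: "t \<in> {0..<T}"
    show "((\<lambda>t. fst (\<xi> t) $ idx n) has_vector_derivative - (\<Sum>i=1..n. \<alpha> i *\<^sub>R fst (\<xi> t) $ idx i))
        (at t within {0..<T})"
      using der[OF t, of n] unfolding last .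
    assume "i \<in> {1..<n}"
    then show "((\<lambda>t. fst (\<xi> t) $ idx i) has_vector_derivative fst (\<xi> t) $ idx (Suc i)) (at t within {0..<T})"
      using der[OF t, of i] by (simp add: chain)
  qed
qed

lemma norm_blocks_le: "norm zp \<le> (\<Sum>i=1..n. norm (zp $ idx i))"
proof -
  have "norm zp \<le> (\<Sum>k\<in>UNIV. norm (zp $ k))"
    unfolding norm_vec_def by (intro L2_set_le_sum) auto
  then show ?thesis by (simp add: sum.reindex_bij_betw[OF bij, symmetric])
qed

lemma sum_blocks_le: "(\<Sum>i=1..n. norm (zp $ idx i)) \<le> n * norm zp"
  using sum_bounded_above[of "{1..n}" "\<lambda>i. norm (zp $ idx i)" "norm zp"] Finite_Cartesian_Product.norm_nth_le[of zp]
  by simp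

lemma chain_state_decay:
  obtains C k where "C > 0" "k > 0"
    "\<And>(f :: ((real ^ 3) ^ 'n) \<times> (real ^ 3) \<Rightarrow> _) T \<xi> t. solves_ode_on f {0..<T} \<xi> \<Longrightarrow> (\<And>x. fst (f x) = chain_field (fst x)) \<Longrightarrow> t \<in> {0..<T} \<Longrightarrow>
       norm (fst (\<xi> t)) \<le> C * norm (fst (\<xi> 0)) * exp (- k * t)"
proof -
  obtain C k where C: "C > 0" "k > 0"
    "\<And>T q t i. chain_on n \<alpha> T (q :: nat \<Rightarrow> real \<Rightarrow> real ^ 3) \<Longrightarrow> t \<in> {0..<T} \<Longrightarrow> i \<in> {1..n} \<Longrightarrow>
       norm (q i t) \<le> C * (\<Sum>i=1..n. norm (q i 0)) * exp (- k * t)"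
    using chain_decay[OF hurwitz] by blast
  have bound: "norm (fst (\<xi> t)) \<le> (n * C * n) * norm (fst (\<xi> 0)) * exp (- k * t)"
    if sol: "solves_ode_on f {0..<T} \<xi>" "\<And>x. fst (f x) = chain_field (fst x)" and t: "t \<in> {0..<T}"
    for f T t and \<xi> :: "real \<Rightarrow> ((real ^ 3) ^ 'n) \<times> (real ^ 3)"
  proof -
    have "norm (fst (\<xi> t)) \<le> (\<Sum>i=1..n. norm (fst (\<xi> t) $ idx i))" by (rule norm_blocks_le)
    also have "\<dots> \<le> (\<Sum>i=1..n. C * (\<Sum>i=1..n. norm (fst (\<xi> 0) $ idx i)) * exp (- k * t))"
      by (intro sum_mono C(3)[OF chain_solution[OF sol] t])
    also have "\<dots> \<le> (\<Sum>i=1..n. C * (n * norm (fst (\<xi> 0))) * exp (- k * t))"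
      using C(1) by (intro sum_mono mult_right_mono mult_left_mono sum_blocks_le) auto
    finally show ?thesis by (simp add: algebra_simps)
  qed
  \<comment> \<open>One \<open>n\<close> comes from summing the blocks at time \<open>t\<close>, the
    other from bounding each initial block by the norm of the whole vector.\<close>
  have "n * C * n > 0" using C n by simp
  from that[OF this C(2)] bound show ?thesis .
qed

text \<open>Tangency is asked at every point of the ambient space, so a solution need not be known
  to stay on the sphere; this yields uniqueness among all ambient solutions.\<close>

lemma sphere_invariant:
  assumes sol: "solves_ode_on f {0..<T} \<xi>" and tangent: "\<And>x. (e - snd x) \<bullet> snd (f x) = 0"
    and t: "t \<in> {0..<T}"
  shows "norm (e - snd (\<xi> t)) = norm (e - snd (\<xi> 0))"
proof -
  define h where "h = (\<lambda>t. (e - snd (\<xi> t)) \<bullet> (e - snd (\<xi> t)))"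
  have "(h has_vector_derivative 0) (at t within {0..<T})" if "t \<in> {0..<T}" for t
  proof -
    have "((\<lambda>t. snd (\<xi> t)) has_vector_derivative snd (f (\<xi> t))) (at t within {0..<T})"
      using sol that unfolding solves_ode_on_def
      by (intro bounded_linear.has_vector_derivative[OF bounded_linear_snd]) auto
    then have d: "((\<lambda>t. e - snd (\<xi> t)) has_vector_derivative - snd (f (\<xi> t))) (at t within {0..<T})"
      by (auto intro!: derivative_eq_intros)
    show ?thesis
      using bounded_bilinear.has_vector_derivative[OF bounded_bilinear_inner d d] tangent[of "\<xi> t"]
      by (simp add: h_def inner_commute)
  qed
  then obtain c where "\<And>t. t \<in> {0..<T} \<Longrightarrow> h t = c"
    using has_vector_derivative_zero_constant[of "{0..<T}" h] by auto
  then have "h t = h 0" using t by auto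
  then show ?thesis by (simp add: h_def norm_eq_sqrt_inner)
qed

text \<open>Clipping is radial, so the truncated field is still tangent to the spheres around \<open>e\<close>, and
  it agrees with the original one on the a priori bounded region.\<close>

definition truncated :: "real \<Rightarrow> ((real ^ 3) ^ 'n) \<times> (real ^ 3) \<Rightarrow> ((real ^ 3) ^ 'n) \<times> (real ^ 3)" where
  "truncated R x = (chain_field (fst x),
     \<gamma> *\<^sub>R cross3 (clip 1 (e - snd x)) (cross3 (clip 1 (e - snd x)) (e - clip R (fst x $ idx 1))))"

lemma truncated_eq:
  assumes "0 < R" "norm (e - snd x) = 1" "norm (fst x) \<le> R"
  shows "truncated R x = E x"
  using assms Finite_Cartesian_Product.norm_nth_le[of "fst x" "idx 1"] by (simp add: truncated_def E_eq clip_id)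

lemma field_properties:
  "fst (E x) = chain_field (fst x)" "(e - snd x) \<bullet> snd (E x) = 0"
  "fst (truncated R x) = chain_field (fst x)" "(e - snd x) \<bullet> snd (truncated R x) = 0"
  by (simp_all add: E_eq truncated_def dot_cross_self clip_def cross_mult_left)

lemma truncated_lipschitz:
  assumes R: "0 < R"
  obtains L where "L > 0" "\<And>x y. norm (truncated R x - truncated R y) \<le> L * norm (x - y)"
proof -
  obtain B where B: "B > 0" "\<And>x. norm (chain_field x) \<le> B * norm x"
    using linear_bounded_pos[OF linear_chain_field] by blast
  \<comment> \<open>\<open>2 * (1 + R)\<close> is the constant of the double cross product for a
    vector of norm at most \<open>1 + R\<close>; the other two factors 2 are Lipschitz constants of
    \<open>clip\<close>.\<close>
  define L where "L = B + \<gamma> * (2 * (1 + R) * 2 + 2)"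
  have "norm (truncated R x - truncated R y) \<le> L * norm (x - y)" for x y
  proof -
    define w w' where "w = clip 1 (e - snd x)" and "w' = clip 1 (e - snd y)"
    define u u' where "u = e - clip R (fst x $ idx 1)" and "u' = e - clip R (fst y $ idx 1)"
    have "norm u \<le> 1 + R"
      unfolding u_def using norm_triangle_ineq4[of e] norm_clip_le[OF R, of "fst x $ idx 1"] e
      by (smt (verit))
    then have "norm (cross3 w (cross3 w u) - cross3 w' (cross3 w' u')) \<le>
        2 * (1 + R) * norm (w - w') + norm (u - u')"
      by (intro double_cross3_lipschitz) (auto simp: w_def w'_def norm_clip_le)
    also have "\<dots> \<le> 2 * (1 + R) * (2 * norm (x - y)) + 2 * norm (x - y)"
    proof (intro add_mono mult_left_mono)
      have "norm (w - w') \<le> 2 * norm ((e - snd x) - (e - snd y))"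
        unfolding w_def w'_def by (rule clip_lipschitz) simp
      also have "norm ((e - snd x) - (e - snd y)) = norm (snd (x - y))"
        by (simp add: norm_minus_commute)
      finally show "norm (w - w') \<le> 2 * norm (x - y)"
        using norm_proj(2)[of "x - y"] by linarith
      have "norm (u - u') = norm (clip R (fst x $ idx 1) - clip R (fst y $ idx 1))"
        by (simp add: u_def u'_def norm_minus_commute)
      also have "\<dots> \<le> 2 * norm (fst (x - y) $ idx 1)"
        using clip_lipschitz[OF R, of "fst x $ idx 1" "fst y $ idx 1"] by simp
      finally show "norm (u - u') \<le> 2 * norm (x - y)"
        using Finite_Cartesian_Product.norm_nth_le[of "fst (x - y)" "idx 1"] norm_proj(1)[of "x - y"] by linarith
    qed (use R in auto)
    finally have "\<gamma> * norm (cross3 w (cross3 w u) - cross3 w' (cross3 w' u')) \<le>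
        \<gamma> * (2 * (1 + R) * (2 * norm (x - y)) + 2 * norm (x - y))"
      using \<gamma> by (intro mult_left_mono) auto
    moreover have "norm (chain_field (fst x) - chain_field (fst y)) \<le> B * norm (x - y)"
    proof -
      have "chain_field (fst x) - chain_field (fst y) = chain_field (fst (x - y))"
        by (simp add: linear_diff[OF linear_chain_field])
      also have "norm \<dots> \<le> B * norm (fst (x - y))" by (rule B)
      also have "\<dots> \<le> B * norm (x - y)"
        using B(1) by (intro mult_left_mono norm_proj(1)) auto
      finally show ?thesis .
    qed
    moreover have "norm (truncated R x - truncated R y) \<le>
        norm (chain_field (fst x) - chain_field (fst y)) +
        \<gamma> * norm (cross3 w (cross3 w u) - cross3 w' (cross3 w' u'))"
    proof -
      have "truncated R x - truncated R y = (chain_field (fst x) - chain_field (fst y),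
          \<gamma> *\<^sub>R (cross3 w (cross3 w u) - cross3 w' (cross3 w' u')))"
        by (simp add: truncated_def w_def w'_def u_def u'_def scaleR_diff_right)
      then show ?thesis using norm_Pair_le \<gamma> by (metis abs_of_pos norm_scaleR)
    qed
    ultimately show ?thesis by (simp add: L_def algebra_simps)
  qed
  moreover have "L > 0" using B(1) \<gamma> R by (simp add: L_def add_pos_pos)
  ultimately show ?thesis using that by blast
qed

lemma Upsilon_iff: "x \<in> Upsilon e \<longleftrightarrow> norm (e - snd x) = 1"
  by (cases x) (simp add: Upsilon_def sphere_at_def)

text \<open>The truncation radius must grow with the initial z_p, so the flow is patched from the
  flows \<open>\<Phi> R\<close>; these agree wherever \<open>R\<close> exceeds the a priori
  bound.\<close>

lemma dynamical_system: "dynamical_system_on E (Upsilon e)"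
proof -
  obtain C k where C: "C > 0" "k > 0" and decay:
    "\<And>(f :: ((real ^ 3) ^ 'n) \<times> (real ^ 3) \<Rightarrow> _) T \<xi> t. solves_ode_on f {0..<T} \<xi> \<Longrightarrow> (\<And>x. fst (f x) = chain_field (fst x)) \<Longrightarrow> t \<in> {0..<T} \<Longrightarrow>
       norm (fst (\<xi> t)) \<le> C * norm (fst (\<xi> 0)) * exp (- k * t)"
    using chain_state_decay by metis
  \<comment> \<open>Holds along solutions of either field: one direction shows that truncated
    solutions solve the system, the other that every solution of the system is a truncated
    one.\<close>
  have agree: "norm (e - snd (\<xi> t)) = 1 \<and> truncated R (\<xi> t) = E (\<xi> t)"
    if sol: "solves_ode_on f {0..<T} \<xi>" and f: "f = E \<or> f = truncated R"
      and R: "0 < R" "C * norm (fst (\<xi> 0)) \<le> R" and start: "\<xi> 0 \<in> Upsilon e" and t: "t \<in> {0..<T}"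
    for f T \<xi> t R
  proof -
    have "norm (fst (\<xi> t)) \<le> C * norm (fst (\<xi> 0)) * exp (- k * t)"
      using f by (intro decay[OF sol _ t]) (auto simp: field_properties)
    also have "\<dots> \<le> C * norm (fst (\<xi> 0)) * 1"
      using C t by (intro mult_left_mono) auto
    finally have "norm (fst (\<xi> t)) \<le> R" using R by simp
    moreover have "(e - snd x) \<bullet> snd (f x) = 0" for x
      using f by (metis field_properties(2,4))
    from sphere_invariant[OF sol this t] have "norm (e - snd (\<xi> t)) = 1"
      using start by (simp add: Upsilon_iff)
    ultimately show ?thesis using truncated_eq R by blast
  qed
  define is_flow where "is_flow R \<phi> \<longleftrightarrow>
      (\<forall>x. \<phi> 0 x = x) \<and> (\<forall>x. solves_ode_on (truncated R) {0..} (\<lambda>t. \<phi> t x)) \<and>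
      continuous_on ({0..} \<times> UNIV) (\<lambda>(t, x). \<phi> t x)" for R \<phi>
  have "\<exists>\<phi>. is_flow R \<phi>" if R: "R > 0" for R
  proof -
    obtain L where L: "L > 0" "\<And>x y. norm (truncated R x - truncated R y) \<le> L * norm (x - y)"
      using truncated_lipschitz[OF R] by blast
    obtain \<phi> where "\<And>x. \<phi> 0 x = x" "\<And>x. solves_ode_on (truncated R) {0..} (\<lambda>t. \<phi> t x)"
      "continuous_on ({0..} \<times> UNIV) (\<lambda>(t, x). \<phi> t x)"
      using lipschitz_flow[OF L(2) L(1)] by blast
    then show ?thesis unfolding is_flow_def by blast
  qed
  then obtain \<Phi> where "\<And>R. R > 0 \<Longrightarrow> is_flow R (\<Phi> R)" by metis
  then have \<Phi>: "\<And>R x. R > 0 \<Longrightarrow> \<Phi> R 0 x = x"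
    "\<And>R x. R > 0 \<Longrightarrow> solves_ode_on (truncated R) {0..} (\<lambda>t. \<Phi> R t x)"
    "\<And>R. R > 0 \<Longrightarrow> continuous_on ({0..} \<times> UNIV) (\<lambda>(t, x). \<Phi> R t x)"
    unfolding is_flow_def by blast+
  have unique: "\<xi> t = \<Phi> R t (\<xi> 0)"
    if sol: "solves_ode_on E {0..<T} \<xi>" and R: "0 < R" "C * norm (fst (\<xi> 0)) \<le> R"
      and start: "\<xi> 0 \<in> Upsilon e" and t: "t \<in> {0..<T}" for T \<xi> t R
  proof -
    obtain L where L: "L > 0" "\<And>x y. norm (truncated R x - truncated R y) \<le> L * norm (x - y)"
      using truncated_lipschitz[OF R(1)] by blast
    have "solves_ode_on (truncated R) {0..<T} \<xi>"
      using sol agree[OF sol _ R start] unfolding solves_ode_on_def by auto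
    moreover have "solves_ode_on (truncated R) {0..<T} (\<lambda>t. \<Phi> R t (\<xi> 0))"
      by (rule solves_ode_on_subset[OF \<Phi>(2)[OF R(1)]]) auto
    ultimately have "norm (\<xi> t - \<Phi> R t (\<xi> 0)) \<le> norm (\<xi> 0 - \<Phi> R 0 (\<xi> 0)) * exp (L * t)"
      by (rule lipschitz_solutions_diverge[OF L(2) _ _ t])
    then show ?thesis using \<Phi>(1)[OF R(1)] by simp
  qed
  have traj: "trajectory E (Upsilon e) (\<lambda>t. \<Phi> R t x)"
    if x: "x \<in> Upsilon e" and R: "0 < R" "C * norm (fst x) \<le> R" for x R
  proof -
    have "norm (e - snd (\<Phi> R t x)) = 1 \<and> truncated R (\<Phi> R t x) = E (\<Phi> R t x)" if "t \<ge> 0" for t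
      using x R that \<Phi>(1)[OF R(1), of x]
      by (intro agree[where T = "t + 1" and f = "truncated R"] solves_ode_on_subset[OF \<Phi>(2)[OF R(1)]]) auto
    then show ?thesis
      using \<Phi>(2)[OF R(1), of x] by (auto simp: trajectory_def solves_ode_on_def Upsilon_iff)
  qed
  \<comment> \<open>The added 1 makes the radius positive even when z_p starts at 0.\<close>
  define \<rho> where "\<rho> = (\<lambda>x :: ((real ^ 3) ^ 'n) \<times> (real ^ 3). C * norm (fst x) + 1)"
  define \<phi> where "\<phi> = (\<lambda>t x. \<Phi> (\<rho> x) t x)"
  have \<rho>: "\<rho> x > 0" "C * norm (fst x) \<le> \<rho> x" for x
    using C(1) by (auto simp: \<rho>_def intro: add_nonneg_pos)
  have \<phi>: "\<phi> 0 x = x" for x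
    using \<Phi>(1) \<rho> by (simp add: \<phi>_def)
  have \<phi>_traj: "trajectory E (Upsilon e) (\<lambda>t. \<phi> t x)" if "x \<in> Upsilon e" for x
    unfolding \<phi>_def using that \<rho> by (rule traj)
  show ?thesis
    unfolding dynamical_system_on_def
  proof (intro exI[of _ \<phi>] conjI ballI allI impI)
    show "continuous_on ({0..} \<times> Upsilon e) (\<lambda>(t, x). \<phi> t x)"
      unfolding continuous_on_eq_continuous_within
    proof clarify
      fix t :: real and zp :: "(real ^ 3) ^ 'n" and z2
      assume t: "t \<ge> 0" and x: "(zp, z2) \<in> Upsilon e"
      define x where "x = (zp, z2)"
      \<comment> \<open>\<open>\<phi>\<close> uses a radius varying with the point; this single
        radius suffices for all points within distance 1 of \<open>x\<close>, so near
        \<open>x\<close> the map \<open>\<phi>\<close> is the continuous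
        \<open>\<Phi> R\<close>.\<close>
      define R where "R = C * (norm (fst x) + 1) + 1"
      have R: "R > 0" using C(1) by (simp add: R_def add_nonneg_pos)
      have cont: "continuous (at (t, x) within {0..} \<times> Upsilon e) (\<lambda>(t, x). \<Phi> R t x)"
        using continuous_on_subset[OF \<Phi>(3)[OF R], of "{0..} \<times> Upsilon e"] t x
        by (auto simp: continuous_on_eq_continuous_within x_def)
      show "continuous (at (t, zp, z2) within {0..} \<times> Upsilon e) (\<lambda>(t, x). \<phi> t x)"
        unfolding x_def[symmetric]
      proof (rule continuous_transform_within[OF cont zero_less_one])
        fix z assume z: "z \<in> {0..} \<times> Upsilon e" "dist z (t, x) < 1"
        obtain s y where [simp]: "z = (s, y)" by (cases z)
        have "dist (fst y) (fst x) < 1"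
          using dist_fst_le[of y x] dist_snd_le[of z "(t, x)"] z(2) by simp
        then have "norm (fst y) \<le> norm (fst x) + 1"
          using norm_triangle_ineq2[of "fst y" "fst x"] by (simp add: dist_norm)
        then have "C * norm (fst y) \<le> C * (norm (fst x) + 1)"
          using C(1) by (intro mult_left_mono) auto
        then have le: "C * norm (fst y) \<le> R" by (simp add: R_def)
        have "solves_ode_on E {0..<s + 1} (\<lambda>t. \<phi> t y)"
          using \<phi>_traj[of y] z(1) by (auto simp: trajectory_def elim: solves_ode_on_subset)
        from unique[OF this R] show "(case z of (t, x) \<Rightarrow> \<Phi> R t x) = (case z of (t, x) \<Rightarrow> \<phi> t x)"
          using le z(1) by (simp add: \<phi>)
      qed (use t x in \<open>auto simp: x_def\<close>)
    qed
  next
    fix x T \<xi> t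
    assume "x \<in> Upsilon e" "solves_ode_on E {0..<T} \<xi> \<and> \<xi> 0 = x" "t \<in> {0..<T}"
    then show "\<xi> t = \<phi> t x"
      using unique[of T \<xi> "\<rho> x" t] \<rho>[of x] by (auto simp: \<phi>_def)
  qed (use \<phi> \<phi>_traj in auto)
qed

lemma trajectory_sphere_tracking:
  assumes "trajectory E (Upsilon e) \<xi>"
  shows "sphere_tracking \<gamma> e (\<lambda>t. fst (\<xi> t) $ idx 1) (\<lambda>t. e - snd (\<xi> t))"
proof
  show norm_w: "norm (e - snd (\<xi> t)) = 1" if "t \<ge> 0" for t
    using assms that by (auto simp: trajectory_def Upsilon_iff)
  fix t :: real assume t: "t \<ge> 0"
  define w u where "w = e - snd (\<xi> t)" and "u = e - fst (\<xi> t) $ idx 1"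
  have "((\<lambda>t. snd (\<xi> t)) has_vector_derivative snd (E (\<xi> t))) (at t within {0..})"
    using assms t unfolding trajectory_def solves_ode_on_def
    by (intro bounded_linear.has_vector_derivative[OF bounded_linear_snd]) auto
  then have "((\<lambda>t. e - snd (\<xi> t)) has_vector_derivative - snd (E (\<xi> t))) (at t within {0..})"
    by (auto intro!: derivative_eq_intros)
  moreover have "- snd (E (\<xi> t)) = \<gamma> *\<^sub>R (u - (w \<bullet> u) *\<^sub>R w)"
  proof -
    have "snd (E (\<xi> t)) = \<gamma> *\<^sub>R ((w \<bullet> u) *\<^sub>R w - (w \<bullet> w) *\<^sub>R u)"
      unfolding E_eq Lagrange w_def u_def by (rule snd_conv)
    moreover have "w \<bullet> w = 1" using norm_w[OF t] by (simp add: w_def norm_eq_1)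
    ultimately show ?thesis by (simp add: scaleR_diff_right)
  qed
  ultimately show "((\<lambda>t. e - snd (\<xi> t)) has_vector_derivative
      \<gamma> *\<^sub>R ((e - fst (\<xi> t) $ idx 1) - ((e - snd (\<xi> t)) \<bullet> (e - fst (\<xi> t) $ idx 1)) *\<^sub>R (e - snd (\<xi> t))))
      (at t within {0..})"
    by (simp add: w_def u_def)
qed (rule \<gamma> e)+

end

section \<open>Stability\<close>

lemma trajectory_shift:
  assumes "trajectory f X \<xi>" "0 \<le> s"
  shows "trajectory f X (\<lambda>t. \<xi> (s + t))"
  using assms unfolding trajectory_def solves_ode_on_def
  by (auto intro!: has_vector_derivative_shift[where U = "{0..}"])

lemma locally_exponentially_stable_imp_locally_stable:
  assumes "locally_exponentially_stable f X x0"
  shows "locally_stable f X x0"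
  unfolding locally_stable_def
proof (intro allI impI)
  fix \<epsilon> :: real assume \<epsilon>: "\<epsilon> > 0"
  obtain \<delta> C k where \<delta>: "\<delta> > 0" "C > 0" "k > 0" and decay:
    "\<And>\<xi> t. trajectory f X \<xi> \<Longrightarrow> dist (\<xi> 0) x0 < \<delta> \<Longrightarrow> t \<ge> 0 \<Longrightarrow>
      dist (\<xi> t) x0 \<le> C * exp (- k * t) * dist (\<xi> 0) x0"
    using assms unfolding locally_exponentially_stable_def by blast
  show "\<exists>\<delta>>0. \<forall>\<xi>. trajectory f X \<xi> \<and> dist (\<xi> 0) x0 < \<delta> \<longrightarrow> (\<forall>t\<ge>0. dist (\<xi> t) x0 < \<epsilon>)"
  proof (intro exI[of _ "min \<delta> (\<epsilon> / C)"] conjI allI impI)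
    fix \<xi> and t :: real
    assume \<xi>: "trajectory f X \<xi> \<and> dist (\<xi> 0) x0 < min \<delta> (\<epsilon> / C)" and t: "t \<ge> 0"
    have "dist (\<xi> t) x0 \<le> C * exp (- k * t) * dist (\<xi> 0) x0"
      using \<xi> t by (intro decay) auto
    also have "\<dots> \<le> C * 1 * dist (\<xi> 0) x0"
      using \<delta> t by (intro mult_right_mono mult_left_mono) auto
    also have "\<dots> < \<epsilon>"
      using \<xi> \<delta>(2) by (simp add: pos_less_divide_eq mult.commute)
    finally show "dist (\<xi> t) x0 < \<epsilon>" .
  qed (use \<delta> \<epsilon> in auto)
qed

lemma locally_exponentially_stable_attracts:
  assumes "locally_exponentially_stable f X x0"
  obtains \<delta> where "\<delta> > 0"
    "\<And>\<xi>. trajectory f X \<xi> \<Longrightarrow> dist (\<xi> 0) x0 < \<delta> \<Longrightarrow> (\<xi> \<longlongrightarrow> x0) at_top"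
proof -
  obtain \<delta> C k where \<delta>: "\<delta> > 0" "C > 0" "k > 0" and decay:
    "\<And>\<xi> t. trajectory f X \<xi> \<Longrightarrow> dist (\<xi> 0) x0 < \<delta> \<Longrightarrow> t \<ge> 0 \<Longrightarrow>
      dist (\<xi> t) x0 \<le> C * exp (- k * t) * dist (\<xi> 0) x0"
    using assms unfolding locally_exponentially_stable_def by blast
  have "(\<xi> \<longlongrightarrow> x0) at_top" if \<xi>: "trajectory f X \<xi>" "dist (\<xi> 0) x0 < \<delta>" for \<xi>
    unfolding tendsto_dist_iff[of \<xi>]
  proof (rule Lim_null_comparison)
    show "eventually (\<lambda>t. norm (dist (\<xi> t) x0) \<le> (C * dist (\<xi> 0) x0) * exp (- k * t)) at_top"
      using eventually_ge_at_top[of 0]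
      by eventually_elim (use decay[OF \<xi>] in \<open>simp add: mult_ac\<close>)
  qed (rule exp_decay_tendsto_0[OF \<delta>(3)])
  with \<delta>(1) show ?thesis using that by blast
qed

text \<open>A convergent orbit enters the exponentially attracted ball at some finite time
  \<open>s\<close>; by continuity of \<open>\<phi> s\<close> so do the orbits of nearby
  points.\<close>

lemma openin_basin:
  assumes cont: "continuous_on ({0..} \<times> X) (\<lambda>(t, x). \<phi> t x)"
    and traj: "\<And>x. x \<in> X \<Longrightarrow> trajectory f X (\<lambda>t. \<phi> t x)"
    and stable: "locally_exponentially_stable f X x0"
  shows "openin (top_of_set X) {x \<in> X. ((\<lambda>t. \<phi> t x) \<longlongrightarrow> x0) at_top}"
proof -
  obtain \<delta> where \<delta>: "\<delta> > 0"
    "\<And>\<xi>. trajectory f X \<xi> \<Longrightarrow> dist (\<xi> 0) x0 < \<delta> \<Longrightarrow> (\<xi> \<longlongrightarrow> x0) at_top"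
    using locally_exponentially_stable_attracts[OF stable] by blast
  show ?thesis
    unfolding openin_euclidean_subtopology_iff
  proof (intro conjI ballI)
    fix x assume "x \<in> {x \<in> X. ((\<lambda>t. \<phi> t x) \<longlongrightarrow> x0) at_top}"
    then have x: "x \<in> X" and lim: "((\<lambda>t. \<phi> t x) \<longlongrightarrow> x0) at_top" by auto
    from lim \<delta>(1) have "eventually (\<lambda>t. dist (\<phi> t x) x0 < \<delta>) at_top"
      by (rule tendstoD)
    then obtain N where "\<And>t. t \<ge> N \<Longrightarrow> dist (\<phi> t x) x0 < \<delta>"
      by (auto simp: eventually_at_top_linorder)
    then obtain s where s: "s \<ge> 0" "dist (\<phi> s x) x0 < \<delta>"
      by (meson max.cobounded1 max.cobounded2)
    have "continuous_on X (\<lambda>x. (\<lambda>(t, x). \<phi> t x) (s, x))"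
      using s(1) by (intro continuous_on_compose2[OF cont]) (auto intro!: continuous_intros)
    then have "continuous_on X (\<phi> s)" by simp
    then obtain r where r: "r > 0"
      "\<And>y. y \<in> X \<Longrightarrow> dist y x < r \<Longrightarrow> dist (\<phi> s y) (\<phi> s x) < \<delta> - dist (\<phi> s x) x0"
      using x s(2) unfolding continuous_on_iff by (metis diff_gt_0_iff_gt)
    have "((\<lambda>t. \<phi> t y) \<longlongrightarrow> x0) at_top" if y: "y \<in> X" "dist y x < r" for y
    proof -
      have "dist (\<phi> s y) x0 < \<delta>"
        using r(2)[OF y] dist_triangle[of "\<phi> s y" x0 "\<phi> s x"] by linarith
      then have "((\<lambda>t. \<phi> (s + t) y) \<longlongrightarrow> x0) at_top"
        using \<delta>(2)[OF trajectory_shift[OF traj[OF y(1)] s(1)]] by simp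
      then show ?thesis by (rule tendsto_at_top_shiftD)
    qed
    with r(1) show "\<exists>r>0. \<forall>y\<in>X. dist y x < r \<longrightarrow> y \<in> {x \<in> X. ((\<lambda>t. \<phi> t x) \<longlongrightarrow> x0) at_top}"
      by blast
  qed auto
qed

section \<open>Equilibria, convergence and the basin of the origin\<close>

context E_system
begin

text \<open>The shift equations kill all blocks but the first, and the closing equation kills that
  one because \<open>\<alpha> 1 > 0\<close>. Then w x (w x e) = 0 with |w| = 1 says (w.e) w = e, so
  w is e or -e.\<close>

lemma equilibria_eq: "equilibria E (Upsilon e) = {(0, 0), (0, 2 *\<^sub>R e)}"
proof (intro equalityI subsetI)
  fix x assume "x \<in> equilibria E (Upsilon e)"
  then have x: "norm (e - snd x) = 1" "E x = 0"
    by (auto simp: equilibria_def Upsilon_iff)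
  define w where "w = e - snd x"
  have chain: "chain_field (fst x) = 0" using x(2) by (simp add: E_eq zero_prod_def)
  have zero: "fst x $ idx i = 0" if "i \<in> {2..n}" for i
  proof -
    have "chain_field (fst x) $ idx (i - 1) = fst x $ idx (i - 1 + 1)"
      unfolding chain_field_def using that by (intro E_field_chain[OF bij]) auto
    then show ?thesis using chain that by simp
  qed
  have "(\<Sum>i=1..n. \<alpha> i *\<^sub>R fst x $ idx i) = 0"
    using chain E_field_last[of n idx \<alpha> 0 0 "fst x" 0] by (simp add: chain_field_def)
  also have "(\<Sum>i=1..n. \<alpha> i *\<^sub>R fst x $ idx i) = (\<Sum>i\<in>{1}. \<alpha> i *\<^sub>R fst x $ idx i)"
    using n zero by (intro sum.mono_neutral_right) auto
  finally have "\<alpha> 1 *\<^sub>R fst x $ idx 1 = 0" by simp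
  moreover have "\<alpha> 1 > 0" using \<alpha> n by auto
  ultimately have one: "fst x $ idx 1 = 0" by simp
  have "fst x $ idx i = 0" if "i \<in> {1..n}" for i
    using zero[of i] one that by (cases "i = 1") auto
  moreover have "k \<in> idx ` {1..n}" for k
    using bij by (auto simp: bij_betw_def)
  ultimately have fst: "fst x = 0"
    unfolding vec_eq_iff[of "fst x"] by (metis imageE zero_index)
  have "cross3 w (cross3 w (e - fst x $ idx 1)) = 0"
    using x(2) \<gamma> by (simp add: E_eq zero_prod_def w_def)
  then have we: "(w \<bullet> e) *\<^sub>R w = e"
    using x(1) by (simp add: fst Lagrange w_def[symmetric] norm_eq_1)
  then have "\<bar>w \<bullet> e\<bar> = 1"
    using x(1) e by (metis norm_scaleR mult.right_neutral w_def)
  then have "w \<bullet> e = 1 \<or> w \<bullet> e = - 1" by linarith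
  then have "w = e \<or> w = - e" using we by (metis minus_minus scaleR_minus1_left scaleR_one)
  then have "snd x = 0 \<or> snd x = 2 *\<^sub>R e"
    by (auto simp: w_def scaleR_2 algebra_simps)
  with fst show "x \<in> {(0, 0), (0, 2 *\<^sub>R e)}" by (cases x) auto
next
  have "chain_field 0 = 0" by (rule linear_0[OF linear_chain_field])
  moreover fix x :: "((real ^ 3) ^ 'n) \<times> (real ^ 3)" assume "x \<in> {(0, 0), (0, 2 *\<^sub>R e)}"
  moreover have flip: "e - 2 *\<^sub>R e = - e" by (simp add: scaleR_2)
  ultimately show "x \<in> equilibria E (Upsilon e)"
    using e by (auto simp: equilibria_def Upsilon_iff E_eq zero_prod_def flip)
qed

lemma card_equilibria: "card (equilibria E (Upsilon e)) = 2"
proof -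
  have "e \<noteq> 0" using e by auto
  then show ?thesis by (simp add: equilibria_eq)
qed

lemma trajectory_solves:
  "trajectory E (Upsilon e) \<xi> \<Longrightarrow> solves_ode_on E {0..<T} \<xi>"
  unfolding trajectory_def by (auto elim: solves_ode_on_subset)

lemma chain_state_trajectory_decay:
  obtains C k where "C > 0" "k > 0"
    "\<And>\<xi> t. trajectory E (Upsilon e) \<xi> \<Longrightarrow> t \<ge> 0 \<Longrightarrow>
       norm (fst (\<xi> t)) \<le> C * norm (fst (\<xi> 0)) * exp (- k * t)"
proof (rule chain_state_decay)
  fix C k assume C: "C > 0" "k > 0" and decay:
    "\<And>(f :: ((real ^ 3) ^ 'n) \<times> (real ^ 3) \<Rightarrow> _) T \<xi> t. solves_ode_on f {0..<T} \<xi> \<Longrightarrow>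
       (\<And>x. fst (f x) = chain_field (fst x)) \<Longrightarrow> t \<in> {0..<T} \<Longrightarrow>
       norm (fst (\<xi> t)) \<le> C * norm (fst (\<xi> 0)) * exp (- k * t)"
  have "norm (fst (\<xi> t)) \<le> C * norm (fst (\<xi> 0)) * exp (- k * t)"
    if "trajectory E (Upsilon e) \<xi>" "t \<ge> 0" for \<xi> t
    using that by (intro decay[OF trajectory_solves[where T = "t + 1"]]) (auto simp: field_properties)
  from that[OF C this] show thesis .
qed

text \<open>The difference of the two chains is a chain with zero initial value, for which the decay
  bound is zero.\<close>

lemma chain_state_determined:
  assumes "trajectory E (Upsilon e) \<xi>" "trajectory E (Upsilon e) \<xi>'" "fst (\<xi> 0) = fst (\<xi>' 0)" "t \<ge> 0"
  shows "fst (\<xi> t) = fst (\<xi>' t)"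
proof -
  obtain C k where "C > 0" "k > 0" and C: "\<And>T q t i. chain_on n \<alpha> T (q :: nat \<Rightarrow> real \<Rightarrow> real ^ 3) \<Longrightarrow> t \<in> {0..<T} \<Longrightarrow>
      i \<in> {1..n} \<Longrightarrow> norm (q i t) \<le> C * (\<Sum>i=1..n. norm (q i 0)) * exp (- k * t)"
    by (rule chain_decay[OF hurwitz]) (rule that)
  have chain: "chain_on n \<alpha> (t + 1) (\<lambda>i t. fst (\<xi> t) $ idx i - fst (\<xi>' t) $ idx i)"
    using assms(1,2) field_properties(1)
    by (intro chain_on_diff chain_solution[where f = E] trajectory_solves)
  have "norm (fst (\<xi> t) $ idx i - fst (\<xi>' t) $ idx i) \<le> 0" if "i \<in> {1..n}" for i
    using C[OF chain _ that, of t] assms(3,4) by simp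
  then have "norm (fst (\<xi> t) - fst (\<xi>' t)) \<le> (\<Sum>i=1..n. 0)"
    by (intro order_trans[OF norm_blocks_le] sum_mono) simp
  then show ?thesis by simp
qed

text \<open>The bound \<open>M\<close> on the first block is kept apart from \<open>M'\<close> for
  the whole chain: only \<open>M\<close> enters the smallness condition, while high gains make the
  other blocks peak. The exponent \<open>\<gamma> * \<delta> / 4\<close> is half the rate of the
  squared distance.\<close>

lemma trajectory_rate:
  assumes traj: "trajectory E (Upsilon e) \<xi>"
    and zp: "\<And>t. t \<ge> 0 \<Longrightarrow> norm (fst (\<xi> t)) \<le> M' * exp (- k * t)"
    and p: "\<And>t. t \<ge> 0 \<Longrightarrow> norm (fst (\<xi> t) $ idx 1) \<le> M * exp (- k * t)" and k: "k > 0"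
    and M: "\<gamma> * M \<le> k * \<delta>" "2 * \<delta> \<le> 1 + (e - snd (\<xi> 0)) \<bullet> e" and \<mu>: "\<gamma> * \<delta> / 2 < 2 * k" and t: "t \<ge> 0"
  shows "norm (\<xi> t) \<le> (M' + sqrt ((norm (snd (\<xi> 0)))\<^sup>2 + \<gamma> * M\<^sup>2 / (2 * k - \<gamma> * \<delta> / 2))) * exp (- (\<gamma> * \<delta> / 4) * t)"
proof -
  interpret sphere_tracking \<gamma> e "\<lambda>t. fst (\<xi> t) $ idx 1" "\<lambda>t. e - snd (\<xi> t)"
    using traj by (rule trajectory_sphere_tracking)
  define A where "A = (norm (snd (\<xi> 0)))\<^sup>2 + \<gamma> * M\<^sup>2 / (2 * k - \<gamma> * \<delta> / 2)"
  have "(norm (snd (\<xi> t)))\<^sup>2 \<le> A * exp (- (\<gamma> * \<delta> / 2) * t)"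
    using tracking_rate[OF p k M \<mu> t] by (simp add: A_def)
  then have "sqrt ((norm (snd (\<xi> t)))\<^sup>2) \<le> sqrt (A * exp (- (\<gamma> * \<delta> / 2) * t))"
    by (rule real_sqrt_le_mono)
  also have "\<dots> = sqrt A * exp (- (\<gamma> * \<delta> / 4) * t)"
  proof -
    have "exp (- (\<gamma> * \<delta> / 2) * t) = (exp (- (\<gamma> * \<delta> / 4) * t))\<^sup>2"
      unfolding power2_eq_square exp_add[symmetric] by (rule arg_cong[where f = exp]) simp
    then show ?thesis by (simp only: real_sqrt_mult real_sqrt_abs abs_exp_cancel)
  qed
  finally have snd_le: "norm (snd (\<xi> t)) \<le> sqrt A * exp (- (\<gamma> * \<delta> / 4) * t)" by simp
  have "M' \<ge> 0" using zp[of 0] order_trans[OF norm_ge_zero] by force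
  moreover have "- k * t \<le> - (\<gamma> * \<delta> / 4) * t"
    using \<mu> t by (intro mult_right_mono) auto
  ultimately have "M' * exp (- k * t) \<le> M' * exp (- (\<gamma> * \<delta> / 4) * t)"
    by (intro mult_left_mono) auto
  then have "norm (fst (\<xi> t)) + norm (snd (\<xi> t)) \<le> (M' + sqrt A) * exp (- (\<gamma> * \<delta> / 4) * t)"
    using zp[OF t] snd_le by (simp add: distrib_right)
  then show ?thesis
    using norm_Pair_le[of "fst (\<xi> t)" "snd (\<xi> t)"] by (simp add: A_def)
qed

lemma trajectory_converges:
  assumes traj: "trajectory E (Upsilon e) \<xi>"
  shows "(\<xi> \<longlongrightarrow> (0, 0)) at_top \<or> (\<xi> \<longlongrightarrow> (0, 2 *\<^sub>R e)) at_top"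
proof -
  interpret sphere_tracking \<gamma> e "\<lambda>t. fst (\<xi> t) $ idx 1" "\<lambda>t. e - snd (\<xi> t)"
    using traj by (rule trajectory_sphere_tracking)
  obtain C k where C: "C > 0" "k > 0" and
    decay: "\<And>\<xi> t. trajectory E (Upsilon e) \<xi> \<Longrightarrow> t \<ge> 0 \<Longrightarrow>
       norm (fst (\<xi> t)) \<le> C * norm (fst (\<xi> 0)) * exp (- k * t)"
    by (rule chain_state_trajectory_decay) (rule that)
  have fst_lim: "((\<lambda>t. fst (\<xi> t)) \<longlongrightarrow> 0) at_top"
  proof (rule Lim_null_comparison)
    show "eventually (\<lambda>t. norm (fst (\<xi> t)) \<le> (C * norm (fst (\<xi> 0))) * exp (- k * t)) at_top"
      using eventually_ge_at_top[of 0] by eventually_elim (rule decay[OF traj])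
  qed (rule exp_decay_tendsto_0[OF C(2)])
  have lim: "(\<xi> \<longlongrightarrow> (0, e - d)) at_top" if "((\<lambda>t. e - snd (\<xi> t)) \<longlongrightarrow> d) at_top" for d
  proof -
    have "((\<lambda>t. e - (e - snd (\<xi> t))) \<longlongrightarrow> e - d) at_top"
      by (intro tendsto_intros that)
    then have "((\<lambda>t. snd (\<xi> t)) \<longlongrightarrow> e - d) at_top" by simp
    from tendsto_Pair[OF fst_lim this] show ?thesis by simp
  qed
  have "((\<lambda>t. e - snd (\<xi> t)) \<longlongrightarrow> e) at_top \<or> ((\<lambda>t. e - snd (\<xi> t)) \<longlongrightarrow> - e) at_top"
  proof (rule tracks_target_or_antipode[OF _ C(2)])
    show "norm (fst (\<xi> t) $ idx 1) \<le> C * norm (fst (\<xi> 0)) * exp (- k * t)" if "t \<ge> 0" for t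
      using decay[OF traj that] Finite_Cartesian_Product.norm_nth_le[of "fst (\<xi> t)" "idx 1"] by linarith
  qed
  then show ?thesis using lim[of e] lim[of "- e"] by (auto simp: scaleR_2)
qed

lemma locally_exponentially_stable_origin: "locally_exponentially_stable E (Upsilon e) (0, 0)"
proof -
  obtain C k where C: "C > 0" "k > 0" and
    decay: "\<And>\<xi> t. trajectory E (Upsilon e) \<xi> \<Longrightarrow> t \<ge> 0 \<Longrightarrow>
       norm (fst (\<xi> t)) \<le> C * norm (fst (\<xi> 0)) * exp (- k * t)"
    by (rule chain_state_trajectory_decay) (rule that)
  \<comment> \<open>Near the origin |z_2| is at most 1, so the height is at least 3/2 and
    \<open>1 / 2\<close> is an admissible margin; \<open>k / \<gamma>\<close> gives
    \<open>\<gamma> * \<delta> \<le> k\<close>.\<close>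
  define \<delta> where "\<delta> = min (1 / 2) (k / \<gamma>)"
  have \<delta>: "\<delta> > 0" "\<delta> \<le> 1 / 2" "\<gamma> * \<delta> \<le> k"
    using C(2) \<gamma> by (auto simp: \<delta>_def min_def field_simps)
  define m where "m = 2 * k - \<gamma> * \<delta> / 2"
  have m: "m > 0" using \<delta>(3) C(2) by (simp add: m_def)
  define D where "D = C + sqrt (1 + \<gamma> * C\<^sup>2 / m)"
  show ?thesis
    unfolding locally_exponentially_stable_def
  proof (intro exI conjI allI impI)
    \<comment> \<open>The second radius turns the smallness condition into
      \<open>\<gamma> * (C * r) \<le> k * \<delta>\<close> for the initial distance
      \<open>r\<close>.\<close>
    show "min 1 (k * \<delta> / (\<gamma> * C)) > 0" using C \<delta> \<gamma> by simp
    show "D > 0" using C(1) \<gamma> m by (simp add: D_def add_pos_nonneg)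
    show "\<gamma> * \<delta> / 4 > 0" using \<gamma> \<delta> by simp
    fix \<xi> and t :: real
    assume "trajectory E (Upsilon e) \<xi> \<and> dist (\<xi> 0) (0, 0) < min 1 (k * \<delta> / (\<gamma> * C))" and t: "t \<ge> 0"
    then have traj: "trajectory E (Upsilon e) \<xi>" and "norm (\<xi> 0) < 1" and "norm (\<xi> 0) < k * \<delta> / (\<gamma> * C)"
      by (auto simp: zero_prod_def[symmetric])
    interpret sphere_tracking \<gamma> e "\<lambda>t. fst (\<xi> t) $ idx 1" "\<lambda>t. e - snd (\<xi> t)"
      using traj by (rule trajectory_sphere_tracking)
    define r where "r = norm (\<xi> 0)"
    have r: "0 \<le> r" "\<gamma> * (C * r) \<le> k * \<delta>"
      using \<open>norm (\<xi> 0) < k * \<delta> / (\<gamma> * C)\<close> C \<gamma> by (auto simp: r_def field_simps)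
    have zp: "norm (fst (\<xi> t)) \<le> C * r * exp (- k * t)" if "t \<ge> 0" for t
    proof -
      have "norm (fst (\<xi> t)) \<le> C * norm (fst (\<xi> 0)) * exp (- k * t)" by (rule decay[OF traj that])
      also have "\<dots> \<le> C * r * exp (- k * t)"
        unfolding r_def using C(1) by (intro mult_right_mono mult_left_mono norm_proj) auto
      finally show ?thesis .
    qed
    have p: "norm (fst (\<xi> t) $ idx 1) \<le> C * r * exp (- k * t)" if "t \<ge> 0" for t
      using zp[OF that] Finite_Cartesian_Product.norm_nth_le[of "fst (\<xi> t)" "idx 1"] by linarith
    have "norm (snd (\<xi> 0)) \<le> 1"
      using \<open>norm (\<xi> 0) < 1\<close> norm_proj(2)[of "\<xi> 0"] by linarith
    then have "(norm (snd (\<xi> 0)))\<^sup>2 \<le> 1" by (simp add: power_le_one)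
    then have height: "2 * \<delta> \<le> 1 + (e - snd (\<xi> 0)) \<bullet> e"
      using distance_height(1)[of 0] \<delta>(2) by simp
    have "\<gamma> * \<delta> / 2 < 2 * k" using \<delta>(3) C(2) by simp
    from trajectory_rate[OF traj zp p C(2) r(2) height this t]
    have "norm (\<xi> t) \<le> (C * r + sqrt ((norm (snd (\<xi> 0)))\<^sup>2 + \<gamma> * (C * r)\<^sup>2 / m)) * exp (- (\<gamma> * \<delta> / 4) * t)"
      by (simp add: m_def)
    \<comment> \<open>Everything under the root is quadratic in \<open>r\<close>, so the bound is
      linear in the initial distance, as exponential stability demands.\<close>
    also have "\<dots> \<le> (D * r) * exp (- (\<gamma> * \<delta> / 4) * t)"
    proof (rule mult_right_mono)
      have "(norm (snd (\<xi> 0)))\<^sup>2 + \<gamma> * (C * r)\<^sup>2 / m \<le> r\<^sup>2 + \<gamma> * (C * r)\<^sup>2 / m"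
        using norm_proj(2)[of "\<xi> 0"] by (simp add: r_def power_mono)
      also have "\<dots> = (1 + \<gamma> * C\<^sup>2 / m) * r\<^sup>2"
        by (simp add: power_mult_distrib algebra_simps)
      finally have "sqrt ((norm (snd (\<xi> 0)))\<^sup>2 + \<gamma> * (C * r)\<^sup>2 / m) \<le> sqrt ((1 + \<gamma> * C\<^sup>2 / m) * r\<^sup>2)"
        by (rule real_sqrt_le_mono)
      also have "\<dots> = sqrt (1 + \<gamma> * C\<^sup>2 / m) * r"
        using r(1) by (simp add: real_sqrt_mult)
      finally show "C * r + sqrt ((norm (snd (\<xi> 0)))\<^sup>2 + \<gamma> * (C * r)\<^sup>2 / m) \<le> D * r"
        by (simp add: D_def distrib_right)
    qed simp
    finally show "dist (\<xi> t) (0, 0) \<le> D * exp (- (\<gamma> * \<delta> / 4) * t) * dist (\<xi> 0) (0, 0)"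
      by (simp add: zero_prod_def[symmetric] r_def mult_ac)
  qed
qed

text \<open>Equal initial chain states give equal chain states forever, so both directions are
  driven by the same perturbation and \<open>sphere_tracking_antipode_unique\<close>
  applies.\<close>

lemma antipodal_limit_unique:
  assumes traj: "trajectory E (Upsilon e) \<xi>" "trajectory E (Upsilon e) \<xi>'" and fst: "fst (\<xi> 0) = fst (\<xi>' 0)"
    and lim: "(\<xi> \<longlongrightarrow> (0, 2 *\<^sub>R e)) at_top" "(\<xi>' \<longlongrightarrow> (0, 2 *\<^sub>R e)) at_top"
  shows "\<xi> 0 = \<xi>' 0"
proof -
  obtain C k where C: "C > 0" "k > 0" and
    decay: "\<And>\<xi> t. trajectory E (Upsilon e) \<xi> \<Longrightarrow> t \<ge> 0 \<Longrightarrow>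
       norm (fst (\<xi> t)) \<le> C * norm (fst (\<xi> 0)) * exp (- k * t)"
    by (rule chain_state_trajectory_decay) (rule that)
  have w_lim: "((\<lambda>t. e - snd (\<xi> t)) \<longlongrightarrow> - e) at_top" if "(\<xi> \<longlongrightarrow> (0, 2 *\<^sub>R e)) at_top"
    for \<xi> :: "real \<Rightarrow> ((real ^ 3) ^ 'n) \<times> (real ^ 3)"
    using tendsto_diff[OF tendsto_const[of e] tendsto_snd[OF that]] by (simp add: scaleR_2)
  have "sphere_tracking \<gamma> e (\<lambda>t. fst (\<xi> t) $ idx 1) (\<lambda>t. e - snd (\<xi>' t))"
  proof -
    interpret w': sphere_tracking \<gamma> e "\<lambda>t. fst (\<xi>' t) $ idx 1" "\<lambda>t. e - snd (\<xi>' t)"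
      using traj(2) by (rule trajectory_sphere_tracking)
    show ?thesis
    proof
      show "((\<lambda>t. e - snd (\<xi>' t)) has_vector_derivative \<gamma> *\<^sub>R ((e - fst (\<xi> t) $ idx 1) -
          ((e - snd (\<xi>' t)) \<bullet> (e - fst (\<xi> t) $ idx 1)) *\<^sub>R (e - snd (\<xi>' t)))) (at t within {0..})"
        if "t \<ge> 0" for t
        using w'.w_derivative[OF that] chain_state_determined[OF traj fst that] by simp
    qed (use \<gamma> e w'.norm_w in auto)
  qed
  moreover have "sphere_tracking \<gamma> e (\<lambda>t. fst (\<xi> t) $ idx 1) (\<lambda>t. e - snd (\<xi> t))"
    using traj(1) by (rule trajectory_sphere_tracking)
  moreover have "norm (fst (\<xi> t) $ idx 1) \<le> C * norm (fst (\<xi> 0))" if "t \<ge> 0" for t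
  proof -
    have "norm (fst (\<xi> t) $ idx 1) \<le> norm (fst (\<xi> t))" by (rule Finite_Cartesian_Product.norm_nth_le)
    also have "\<dots> \<le> C * norm (fst (\<xi> 0)) * exp (- k * t)" by (rule decay[OF traj(1) that])
    also have "\<dots> \<le> C * norm (fst (\<xi> 0)) * 1" using C that by (intro mult_left_mono) auto
    finally show ?thesis by simp
  qed
  moreover have "((\<lambda>t. fst (\<xi> t) $ idx 1) \<longlongrightarrow> 0) at_top"
    using tendsto_vec_nth[OF tendsto_fst[OF lim(1)], of "idx 1"] by simp
  ultimately have "e - snd (\<xi> 0) = e - snd (\<xi>' 0)"
    using w_lim[OF lim(1)] w_lim[OF lim(2)] sphere_tracking_antipode_unique[where w = "\<lambda>t. e - snd (\<xi> t)"] by blast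
  with fst show ?thesis by (simp add: prod_eq_iff)
qed

lemma almost_globally_asymptotically_stable_origin:
  "almost_globally_asymptotically_stable E (Upsilon e) (0, 0)"
proof -
  obtain \<phi> where cont: "continuous_on ({0..} \<times> Upsilon e) (\<lambda>(t, x). \<phi> t x)"
    and \<phi>: "\<And>x. x \<in> Upsilon e \<Longrightarrow> \<phi> 0 x = x" "\<And>x. x \<in> Upsilon e \<Longrightarrow> trajectory E (Upsilon e) (\<lambda>t. \<phi> t x)"
    and unique: "\<And>x T \<xi> t. x \<in> Upsilon e \<Longrightarrow> T > 0 \<Longrightarrow> solves_ode_on E {0..<T} \<xi> \<Longrightarrow> \<xi> 0 = x \<Longrightarrow>
      t \<in> {0..<T} \<Longrightarrow> \<xi> t = \<phi> t x"
    using dynamical_system unfolding dynamical_system_on_def by metis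
  define X1 where "X1 = {x \<in> Upsilon e. ((\<lambda>t. \<phi> t x) \<longlongrightarrow> (0, 0)) at_top}"
  have "openin (top_of_set (Upsilon e)) X1"
    unfolding X1_def by (rule openin_basin[OF cont \<phi>(2) locally_exponentially_stable_origin])
  moreover have "Upsilon e \<subseteq> closure X1"
  proof
    fix x :: "((real ^ 3) ^ 'n) \<times> (real ^ 3)" assume x: "x \<in> Upsilon e"
    show "x \<in> closure X1"
    proof (cases "x \<in> X1")
      case False
      then have lim: "((\<lambda>t. \<phi> t x) \<longlongrightarrow> (0, 2 *\<^sub>R e)) at_top"
        using trajectory_converges[OF \<phi>(2)[OF x]] x by (auto simp: X1_def)
      show ?thesis
        unfolding closure_approachable
      proof (intro allI impI)
        fix \<epsilon> :: real assume \<epsilon>: "\<epsilon> > 0"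
        \<comment> \<open>The sphere is connected and contains both 0 and
          \<open>2 *\<^sub>R e\<close>, hence has no isolated point: z_2 can be moved slightly while
          z_p is kept.\<close>
        have "snd x islimpt sphere e 1"
        proof (rule connected_imp_perfect)
          show "connected (sphere e 1)" by (rule connected_sphere) simp
          show "snd x \<in> sphere e 1" using x by (simp add: Upsilon_iff dist_norm)
          show "sphere e 1 \<noteq> {z}" for z
          proof
            assume eq: "sphere e 1 = {z}"
            have "0 \<in> sphere e 1" "2 *\<^sub>R e \<in> sphere e 1"
              using e by (simp_all add: dist_norm scaleR_2)
            then have "2 *\<^sub>R e = 0" unfolding eq by simp
            with e show False by auto
          qed
        qed
        then obtain z where z: "z \<in> sphere e 1" "z \<noteq> snd x" "dist z (snd x) < \<epsilon>"
          using \<epsilon> unfolding islimpt_approachable by blast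
        define y where "y = (fst x, z)"
        have y: "y \<in> Upsilon e" using z(1) by (simp add: y_def Upsilon_iff dist_norm)
        have "\<not> ((\<lambda>t. \<phi> t y) \<longlongrightarrow> (0, 2 *\<^sub>R e)) at_top"
        proof
          assume "((\<lambda>t. \<phi> t y) \<longlongrightarrow> (0, 2 *\<^sub>R e)) at_top"
          then have "\<phi> 0 x = \<phi> 0 y"
            using \<phi> x y by (intro antipodal_limit_unique[OF _ _ _ lim]) (auto simp: y_def)
          then have "x = y" using \<phi>(1) x y by metis
          then show False using z(2) by (metis snd_conv y_def)
        qed
        then have "y \<in> X1"
          using trajectory_converges[OF \<phi>(2)[OF y]] y by (auto simp: X1_def)
        moreover have "dist y x < \<epsilon>"
          using z(3) by (simp add: y_def dist_prod_def)
        ultimately show "\<exists>y\<in>X1. dist y x < \<epsilon>" by blast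
      qed
    qed (use closure_subset in auto)
  qed
  moreover have "(\<xi> \<longlongrightarrow> (0, 0)) at_top" if \<xi>: "trajectory E (Upsilon e) \<xi>" "\<xi> 0 \<in> X1" for \<xi>
  proof -
    have eq: "\<xi> t = \<phi> t (\<xi> 0)" if "t \<ge> 0" for t
    proof (rule unique[OF _ _ trajectory_solves[OF \<xi>(1)]])
      show "\<xi> 0 \<in> Upsilon e" using \<xi>(2) by (simp add: X1_def)
      show "t \<in> {0..<t + 1}" "t + 1 > 0" using that by auto
    qed simp
    have "eventually (\<lambda>t. \<phi> t (\<xi> 0) = \<xi> t) at_top"
      by (rule eventually_mono[OF eventually_ge_at_top[of 0]]) (rule eq[symmetric])
    moreover have "((\<lambda>t. \<phi> t (\<xi> 0)) \<longlongrightarrow> (0, 0)) at_top" using \<xi>(2) by (simp add: X1_def)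
    ultimately show ?thesis by (rule Lim_transform_eventually[rotated])
  qed
  ultimately show ?thesis
    unfolding almost_globally_asymptotically_stable_def equilibria_eq
    using locally_exponentially_stable_imp_locally_stable[OF locally_exponentially_stable_origin]
    by (intro conjI exI[of _ X1]) auto
qed

end

section \<open>High-gain tuning\<close>

text \<open>The new polynomial at s is a^n times the old one at s/a, so its roots are the old ones
  multiplied by a > 0.\<close>

lemma hurwitz_rescaled:
  assumes "hurwitz (char_poly_of_gains n \<alpha>)" "a > 0"
  shows "hurwitz (char_poly_of_gains n (\<lambda>i. a ^ (n + 1 - i) * \<alpha> i))"
  unfolding hurwitz_def
proof (intro allI impI)
  fix s :: complex
  have eval: "poly (map_poly of_real (char_poly_of_gains n \<beta>)) z = z ^ n + (\<Sum>i<n. of_real (\<beta> (Suc i)) * z ^ i)"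
    for \<beta> and z :: complex
    by (simp add: poly_altdef degree_map_poly degree_char_poly_of_gains coeff_map_poly
        coeff_char_poly_of_gains lessThan_Suc_atMost[symmetric])
  assume "poly (map_poly of_real (char_poly_of_gains n (\<lambda>i. a ^ (n + 1 - i) * \<alpha> i))) s = 0"
  moreover have "poly (map_poly of_real (char_poly_of_gains n (\<lambda>i. a ^ (n + 1 - i) * \<alpha> i))) s =
      of_real a ^ n * poly (map_poly of_real (char_poly_of_gains n \<alpha>)) (s / of_real a)"
  proof -
    have "of_real a ^ n * (of_real (\<alpha> (Suc i)) * (s / of_real a) ^ i) =
        of_real (a ^ (n + 1 - Suc i) * \<alpha> (Suc i)) * s ^ i" if "i < n" for i
      using assms(2) that by (simp add: power_diff power_divide)
    then show ?thesis
      using assms(2) by (simp add: eval distrib_left sum_distrib_left power_divide)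
  qed
  ultimately have "poly (map_poly of_real (char_poly_of_gains n \<alpha>)) (s / of_real a) = 0"
    using assms(2) by simp
  then have "Re (s / of_real a) < 0" using assms(1) unfolding hurwitz_def by blast
  then show "Re s < 0" using assms(2) by (simp add: divide_less_0_iff)
qed

text \<open>With time slowed by \<open>a\<close>, each further derivative costs one factor
  \<open>1 / a\<close>, so block \<open>i\<close> is divided by \<open>a ^ (i - 1)\<close>. The
  weight \<open>a ^ (n + 1 - i)\<close> is exactly what this division cancels in the closing
  equation.\<close>

lemma chain_on_rescaled:
  assumes "chain_on n (\<lambda>i. a ^ (n + 1 - i) * \<alpha> i) T q" "a > 0" "n > 0"
  shows "chain_on n \<alpha> (a * T) (\<lambda>i t. (1 / a) ^ (i - 1) *\<^sub>R q i (t / a))"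
proof -
  have der: "((\<lambda>t. (1 / a) ^ (i - 1) *\<^sub>R q i (t / a)) has_vector_derivative (1 / a) ^ i *\<^sub>R d)
      (at t within {0..<a * T})"
    if d: "(q i has_vector_derivative d) (at (t / a) within {0..<T})" and i: "i \<ge> 1" for i t d
  proof -
    have "((\<lambda>t. t / a) has_vector_derivative 1 / a) (at t within {0..<a * T})"
      using assms(2) unfolding has_real_derivative_iff_has_vector_derivative[symmetric]
      by (auto intro!: derivative_eq_intros)
    moreover have "(q i has_vector_derivative d) (at (t / a) within (\<lambda>t. t / a) ` {0..<a * T})"
      using assms(2) by (intro has_vector_derivative_within_subset[OF d]) (auto simp: field_simps)
    ultimately have "((\<lambda>t. q i (t / a)) has_vector_derivative (1 / a) *\<^sub>R d) (at t within {0..<a * T})"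
      using vector_diff_chain_within[of "\<lambda>t. t / a" "1 / a" t "{0..<a * T}" "q i" d] by (simp add: o_def)
    then have "((\<lambda>t. (1 / a) ^ (i - 1) *\<^sub>R q i (t / a)) has_vector_derivative
        (1 / a) ^ (i - 1) *\<^sub>R ((1 / a) *\<^sub>R d)) (at t within {0..<a * T})"
      by (rule bounded_linear.has_vector_derivative[OF bounded_linear_scaleR_right])
    moreover have "(1 / a) ^ (i - 1) * (1 / a) = (1 / a) ^ i"
      using i by (cases i) auto
    ultimately show ?thesis by (simp only: scaleR_scaleR)
  qed
  show ?thesis
    unfolding chain_on_def
  proof (intro ballI conjI)
    fix t assume "t \<in> {0..<a * T}"
    then have t: "t / a \<in> {0..<T}" using assms(2) by (auto simp: field_simps)
    show "((\<lambda>t. (1 / a) ^ (i - 1) *\<^sub>R q i (t / a)) has_vector_derivative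
        (1 / a) ^ (Suc i - 1) *\<^sub>R q (Suc i) (t / a)) (at t within {0..<a * T})" if "i \<in> {1..<n}" for i
      using der[of i "q (Suc i) (t / a)" t] assms(1) t that by (simp add: chain_on_def)
    have "((\<lambda>t. (1 / a) ^ (n - 1) *\<^sub>R q n (t / a)) has_vector_derivative
        (1 / a) ^ n *\<^sub>R - (\<Sum>i=1..n. (a ^ (n + 1 - i) * \<alpha> i) *\<^sub>R q i (t / a))) (at t within {0..<a * T})"
      using assms(1,3) t by (intro der) (auto simp: chain_on_def)
    moreover have "(1 / a) ^ n *\<^sub>R - (\<Sum>i=1..n. (a ^ (n + 1 - i) * \<alpha> i) *\<^sub>R q i (t / a)) =
        - (\<Sum>i=1..n. \<alpha> i *\<^sub>R (1 / a) ^ (i - 1) *\<^sub>R q i (t / a))"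
    proof -
      have "(1 / a) ^ n * (a ^ (n + 1 - i) * \<alpha> i) = \<alpha> i * (1 / a) ^ (i - 1)" if "i \<in> {1..n}" for i
      proof -
        have "a ^ n = a ^ (n + 1 - i) * a ^ (i - 1)"
          using that by (simp add: power_add[symmetric])
        then show ?thesis using assms(2) by (simp add: power_divide)
      qed
      then show ?thesis
        unfolding scaleR_minus_right scaleR_sum_right scaleR_scaleR
        by (intro arg_cong[where f = uminus] sum.cong refl) (simp only:)
    qed
    ultimately show "((\<lambda>t. (1 / a) ^ (n - 1) *\<^sub>R q n (t / a)) has_vector_derivative
        - (\<Sum>i=1..n. \<alpha> i *\<^sub>R (1 / a) ^ (i - 1) *\<^sub>R q i (t / a))) (at t within {0..<a * T})"
      by simp
  qed
qed

context E_system
begin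

text \<open>Speeding up the chain by a factor \<open>a\<close> leaves the overshoot of the first block bounded
  independently of \<open>a\<close>; only the higher blocks peak, by powers of \<open>a\<close>.\<close>

lemma rescaled_decay:
  obtains C k where "C > 0" "k > 0"
    "\<And>a \<gamma>' \<xi> t i. a \<ge> 1 \<Longrightarrow>
       trajectory (E_field n idx (\<lambda>i. a ^ (n + 1 - i) * \<alpha> i) \<gamma>' e) (Upsilon e) \<xi> \<Longrightarrow> \<gamma>' > 0 \<Longrightarrow>
       t \<ge> 0 \<Longrightarrow> i \<in> {1..n} \<Longrightarrow>
       norm (fst (\<xi> t) $ idx i) \<le> a ^ (i - 1) * (C * norm (\<xi> 0)) * exp (- (k * a) * t)"
proof (rule chain_decay[OF hurwitz])
  fix C k assume C: "C > 0" "k > 0" and decay: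
    "\<And>T q t i. chain_on n \<alpha> T (q :: nat \<Rightarrow> real \<Rightarrow> real ^ 3) \<Longrightarrow> t \<in> {0..<T} \<Longrightarrow> i \<in> {1..n} \<Longrightarrow>
       norm (q i t) \<le> C * (\<Sum>i=1..n. norm (q i 0)) * exp (- k * t)"
  have bound: "norm (fst (\<xi> t) $ idx i) \<le> a ^ (i - 1) * (C * n * norm (\<xi> 0)) * exp (- (k * a) * t)"
    if a: "a \<ge> 1" and traj: "trajectory (E_field n idx (\<lambda>i. a ^ (n + 1 - i) * \<alpha> i) \<gamma>' e) (Upsilon e) \<xi>"
      and \<gamma>': "\<gamma>' > 0" and t: "t \<ge> 0" and i: "i \<in> {1..n}" for a \<gamma>' \<xi> t i
  proof -
    interpret fast: E_system n idx "\<lambda>i. a ^ (n + 1 - i) * \<alpha> i" \<gamma>' e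
      using n bij \<gamma>' \<alpha> e hurwitz_rescaled[OF hurwitz, of a] a by unfold_locales auto
    define q where "q = (\<lambda>i t. (1 / a) ^ (i - 1) *\<^sub>R fst (\<xi> (t / a)) $ idx i)"
    have "chain_on n (\<lambda>i. a ^ (n + 1 - i) * \<alpha> i) (t + 1) (\<lambda>i t. fst (\<xi> t) $ idx i)"
      by (rule fast.chain_solution[OF fast.trajectory_solves[OF traj] fast.field_properties(1)])
    from chain_on_rescaled[OF this] have q: "chain_on n \<alpha> (a * (t + 1)) q"
      using a n by (simp add: q_def)
    \<comment> \<open>Since \<open>a \<ge> 1\<close>, the rescaling does not enlarge the initial
      blocks; only undoing it at time \<open>t\<close> costs \<open>a ^ (i - 1)\<close>, which is 1
      for the first block.\<close>
    have "norm (q i 0) \<le> norm (\<xi> 0)" for i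
    proof -
      have "norm (q i 0) = (1 / a) ^ (i - 1) * norm (fst (\<xi> 0) $ idx i)"
        using a by (simp add: q_def)
      also have "\<dots> \<le> 1 * norm (\<xi> 0)"
        using a Finite_Cartesian_Product.norm_nth_le[of "fst (\<xi> 0)" "idx i"] norm_proj(1)[of "\<xi> 0"]
        by (intro mult_mono power_le_one) auto
      finally show ?thesis by simp
    qed
    then have start: "(\<Sum>i=1..n. norm (q i 0)) \<le> n * norm (\<xi> 0)"
      using sum_bounded_above[of "{1..n}" "\<lambda>i. norm (q i 0)" "norm (\<xi> 0)"] by simp
    have "norm (q i (a * t)) \<le> C * (\<Sum>i=1..n. norm (q i 0)) * exp (- k * (a * t))"
      using a t by (intro decay[OF q _ i]) (auto simp: distrib_left intro: add_nonneg_pos)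
    also have "\<dots> \<le> C * (n * norm (\<xi> 0)) * exp (- k * (a * t))"
      using C(1) start by (intro mult_right_mono mult_left_mono) auto
    finally have "a ^ (i - 1) * norm (q i (a * t)) \<le> a ^ (i - 1) * (C * (n * norm (\<xi> 0)) * exp (- k * (a * t)))"
      using a by (intro mult_left_mono) auto
    moreover have "norm (fst (\<xi> t) $ idx i) = a ^ (i - 1) * norm (q i (a * t))"
      using a by (simp add: q_def power_divide)
    ultimately show ?thesis by (simp add: mult_ac)
  qed
  have "C * n > 0" using C n by simp
  from that[OF this C(2) bound] show thesis .
qed

text \<open>The Hurwitz gains \<open>\<alpha>\<close> of the locale are the seed to be rescaled. The
  gain \<open>\<gamma>'\<close> is fixed first, from the rate and the height margin on
  \<open>K\<close>; only then is the chain made fast enough for that gain.\<close>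

lemma exists_gains_for_rate:
  assumes K: "compact K" "K \<subseteq> Upsilon_star e" and \<rho>: "\<rho> > 0"
  shows "\<exists>\<alpha>' \<gamma>'. (\<forall>i\<in>{1..n}. \<alpha>' i > 0) \<and> \<gamma>' > 0 \<and> hurwitz (char_poly_of_gains n \<alpha>') \<and>
    (\<forall>\<xi>. trajectory (E_field n idx \<alpha>' \<gamma>' e) (Upsilon e) \<xi> \<and> \<xi> 0 \<in> K \<longrightarrow> converges_exp_rate \<xi> \<rho>)"
proof (rule rescaled_decay)
  fix C k assume C: "C > 0" "k > 0" and decay:
    "\<And>a \<gamma>' \<xi> t i. a \<ge> 1 \<Longrightarrow>
       trajectory (E_field n idx (\<lambda>i. a ^ (n + 1 - i) * \<alpha> i) \<gamma>' e) (Upsilon e) \<xi> \<Longrightarrow> \<gamma>' > 0 \<Longrightarrow>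
       t \<ge> 0 \<Longrightarrow> i \<in> {1..n} \<Longrightarrow>
       norm (fst (\<xi> t) $ idx i) \<le> a ^ (i - 1) * (C * norm (\<xi> 0)) * exp (- (k * a) * t)"
  obtain B where B: "B > 0" "\<And>x. x \<in> K \<Longrightarrow> norm x \<le> B"
    using compact_imp_bounded[OF K(1)] by (auto simp: bounded_pos)
  have height_pos: "0 < 1 + (e - snd x) \<bullet> e" if "x \<in> K" for x
  proof -
    define w where "w = e - snd x"
    have "norm w = 1" "snd x \<noteq> 2 *\<^sub>R e"
      using K(2) that by (auto simp: w_def Upsilon_star_def sphere_at_def)
    moreover have "snd x = 2 *\<^sub>R e" if "w + e = 0"
      using that by (simp add: w_def scaleR_2 algebra_simps)
    moreover have "(norm (w + e))\<^sup>2 = 2 * (1 + w \<bullet> e)"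
      using \<open>norm w = 1\<close> e
      by (simp add: power2_norm_eq_inner norm_eq_1 inner_add inner_commute)
    ultimately have "0 < 2 * (1 + w \<bullet> e)"
      by (metis zero_less_power2 norm_eq_zero)
    then show ?thesis by (simp add: w_def)
  qed
  \<comment> \<open>Removing \<open>2 *\<^sub>R e\<close> makes the height positive at each point of
    \<open>K\<close>, and compactness makes it uniformly so; \<open>\<delta>\<close> is half the
    minimum.\<close>
  obtain \<delta> where \<delta>: "\<delta> > 0" "\<And>x. x \<in> K \<Longrightarrow> 2 * \<delta> \<le> 1 + (e - snd x) \<bullet> e"
  proof (cases "K = {}")
    case False
    have "continuous_on K (\<lambda>x. 1 + (e - snd x) \<bullet> e)"
      by (intro continuous_intros)
    from continuous_attains_inf[OF K(1) False this] obtain x where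
      "x \<in> K" "\<And>y. y \<in> K \<Longrightarrow> 1 + (e - snd x) \<bullet> e \<le> 1 + (e - snd y) \<bullet> e"
      by blast
    then show ?thesis
      using height_pos[of x] by (intro that[of "(1 + (e - snd x) \<bullet> e) / 2"]) auto
  qed (use that[of 1] in auto)
  \<comment> \<open>Makes the rate \<open>\<gamma>' * \<delta> / 4\<close> of
    \<open>trajectory_rate\<close> equal to \<open>\<rho>\<close>.\<close>
  define \<gamma>' where "\<gamma>' = 4 * \<rho> / \<delta>"
  \<comment> \<open>The three summands secure in turn \<open>a \<ge> 1\<close>, the overshoot
    condition \<open>\<gamma>' * (C * B) \<le> k * a * \<delta>\<close>, and
    \<open>\<rho> < k * a\<close>, which gives
    \<open>\<gamma>' * \<delta> / 2 < 2 * (k * a)\<close>.\<close>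
  define a where "a = 1 + \<gamma>' * (C * B) / (k * \<delta>) + \<rho> / k"
  define \<alpha>' where "\<alpha>' = (\<lambda>i. a ^ (n + 1 - i) * \<alpha> i)"
  have \<gamma>': "\<gamma>' > 0" "\<gamma>' * \<delta> = 4 * \<rho>" using \<delta>(1) \<rho> by (auto simp: \<gamma>'_def)
  have nonneg: "0 \<le> \<gamma>' * (C * B) / (k * \<delta>)" "0 \<le> \<rho> / k"
    using \<gamma>' C B(1) \<delta>(1) \<rho> by auto
  then have a: "a \<ge> 1" by (simp add: a_def)
  have ka: "k * a > 0" using C(2) a by simp
  have "k * (\<rho> / k) < k * a" using C(2) nonneg by (intro mult_strict_left_mono) (auto simp: a_def)
  then have \<mu>: "\<gamma>' * \<delta> / 2 < 2 * (k * a)" using C(2) \<gamma>'(2) by simp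
  have "k * \<delta> * (\<gamma>' * (C * B) / (k * \<delta>)) \<le> k * \<delta> * a"
    using C(2) \<delta>(1) nonneg by (intro mult_left_mono) (auto simp: a_def)
  then have overshoot: "\<gamma>' * (C * B) \<le> k * a * \<delta>"
    using C(2) \<delta>(1) by (simp add: mult_ac)
  interpret fast: E_system n idx \<alpha>' \<gamma>' e
    using n bij \<gamma>' \<alpha> e hurwitz_rescaled[OF hurwitz, of a] a by unfold_locales (auto simp: \<alpha>'_def)
  have "converges_exp_rate \<xi> \<rho>"
    if traj: "trajectory (E_field n idx \<alpha>' \<gamma>' e) (Upsilon e) \<xi>" and start: "\<xi> 0 \<in> K" for \<xi>
  proof -
    have blocks: "norm (fst (\<xi> t) $ idx i) \<le> a ^ (i - 1) * (C * B) * exp (- (k * a) * t)"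
      if "t \<ge> 0" "i \<in> {1..n}" for t i
    proof -
      have "norm (fst (\<xi> t) $ idx i) \<le> a ^ (i - 1) * (C * norm (\<xi> 0)) * exp (- (k * a) * t)"
        using decay[OF a] traj \<gamma>'(1) that by (simp add: \<alpha>'_def)
      also have "\<dots> \<le> a ^ (i - 1) * (C * B) * exp (- (k * a) * t)"
        using a C(1) B(2)[OF start] by (intro mult_right_mono mult_left_mono) auto
      finally show ?thesis .
    qed
    define M' where "M' = (\<Sum>i=1..n. a ^ (i - 1) * (C * B))"
    have zp: "norm (fst (\<xi> t)) \<le> M' * exp (- (k * a) * t)" if "t \<ge> 0" for t
    proof -
      have "norm (fst (\<xi> t)) \<le> (\<Sum>i=1..n. norm (fst (\<xi> t) $ idx i))" by (rule norm_blocks_le)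
      also have "\<dots> \<le> (\<Sum>i=1..n. a ^ (i - 1) * (C * B) * exp (- (k * a) * t))"
        by (intro sum_mono blocks that)
      finally show ?thesis by (simp only: M'_def sum_distrib_right)
    qed
    have p: "norm (fst (\<xi> t) $ idx 1) \<le> C * B * exp (- (k * a) * t)" if "t \<ge> 0" for t
      using blocks[OF that, of 1] n by simp
    define A where "A = M' + sqrt ((norm (snd (\<xi> 0)))\<^sup>2 + \<gamma>' * (C * B)\<^sup>2 / (2 * (k * a) - \<gamma>' * \<delta> / 2))"
    have "norm (\<xi> t) \<le> A * exp (- \<rho> * t)" if t: "t \<ge> 0" for t
      using fast.trajectory_rate[OF traj zp p ka overshoot \<delta>(2)[OF start] \<mu> t] \<gamma>'(2)
      by (simp add: A_def)
    moreover have "A > 0"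
    proof -
      have "M' > 0"
        unfolding M'_def using a B(1) C(1) n by (intro sum_pos) auto
      moreover have "0 \<le> \<gamma>' * (C * B)\<^sup>2 / (2 * (k * a) - \<gamma>' * \<delta> / 2)"
        using \<gamma>'(1) \<mu> by simp
      ultimately show ?thesis by (simp add: A_def add_pos_nonneg)
    qed
    ultimately show ?thesis unfolding converges_exp_rate_def by blast
  qed
  then show ?thesis
    using fast.\<alpha> fast.\<gamma> fast.hurwitz by blast
qed

end

theorem theorem3:
  fixes n :: nat and idx :: "nat \<Rightarrow> 'n::finite"
    and \<alpha> :: "nat \<Rightarrow> real" and \<gamma> :: real and e :: "real ^ 3"
  assumes "n \<ge> 2" and "bij_betw idx {1..n} (UNIV :: 'n set)"
    and "\<gamma> > 0" and "\<forall>i\<in>{1..n}. \<alpha> i > 0" and "hurwitz (char_poly_of_gains n \<alpha>)"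
    and "norm e = 1"
  shows
    "(dynamical_system_on (E_field n idx \<alpha> \<gamma> e) (Upsilon e) \<and>
      equilibria (E_field n idx \<alpha> \<gamma> e) (Upsilon e) = {(0, 0), (0, 2 *\<^sub>R e)} \<and>
      card (equilibria (E_field n idx \<alpha> \<gamma> e) (Upsilon e)) = 2 \<and>
      (\<forall>\<xi>. trajectory (E_field n idx \<alpha> \<gamma> e) (Upsilon e) \<xi> \<longrightarrow>
         (\<xi> \<longlongrightarrow> (0, 0)) at_top \<or> (\<xi> \<longlongrightarrow> (0, 2 *\<^sub>R e)) at_top)) \<and>
     (almost_globally_asymptotically_stable (E_field n idx \<alpha> \<gamma> e) (Upsilon e) (0, 0) \<and>
      locally_exponentially_stable (E_field n idx \<alpha> \<gamma> e) (Upsilon e) (0, 0)) \<and>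
     (\<forall>K \<rho>. compact K \<and> K \<subseteq> Upsilon_star e \<and> \<rho> > 0 \<longrightarrow>
        (\<exists>\<alpha>' \<gamma>'. (\<forall>i\<in>{1..n}. \<alpha>' i > 0) \<and> \<gamma>' > 0 \<and>
           hurwitz (char_poly_of_gains n \<alpha>') \<and>
           (\<forall>\<xi>. trajectory (E_field n idx \<alpha>' \<gamma>' e) (Upsilon e) \<xi> \<and> \<xi> 0 \<in> K \<longrightarrow>
              converges_exp_rate \<xi> \<rho>)))"
proof -
  interpret E_system n idx \<alpha> \<gamma> e
    using assms by unfold_locales
  show ?thesis
    by (intro conjI allI impI dynamical_system equilibria_eq card_equilibria trajectory_converges
        almost_globally_asymptotically_stable_origin locally_exponentially_stable_origin
        exists_gains_for_rate) (blast+)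
qed

end
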